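(* Let $S$ be a closed densely defined linear operator on a (complex) Banach space $V$ such that (i) $\mathrm i\mathbb R\subset\varrho(S)$; (ii) $S$ is bisectorial with angle $\theta\in[0,\pi/2[$ and radius $r\ge0$; (iii) the integral $\int_{\mathrm i\mathbb R}'(S-z)^{-1}x\,dz$ exists for all $x\in V$. Let $R$ be $p$-subordinate to $S$ with $p<1$. If $\mathrm i\mathbb R\subset r(S+R)$, then $S+R$ is dichotomous with dichotomy gap $h>0$, the corresponding projections $P_\pm$ satisfy \[\frac1{\pi\mathrm i}\int_{\mathrm i\mathbb R}'(S+R-z)^{-1}x\,dz=P_+x-P_-x,\qquad x\in V,\] and $S+R$ is bisectorial with some angle $\theta''\in\,]\theta,\pi/2[$. Moreover, for every $\theta'\in\,]\theta,\pi/2[$ there exists $r'\ge r$ such that $S+R$ is also bisectorial with angle $\theta'$ and radius $r'$ and \[\{z\in\mathbb C:|\operatorname{Re}z|<h\}\cup\Omega_{\theta'',0}\cup\Omega_{\theta',r'}\subset\varrho(S+R).\]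
   Context: $\mathcal D(\cdot)$ is the domain, $\varrho(\cdot)$ the resolvent set, $\sigma(\cdot)$ the spectrum; $\mathbb C_\pm$ are the open right/left half-planes. $S+R$ has domain $\mathcal D(S)\cap\mathcal D(R)=\mathcal D(S)$. $\int'_{\mathrm i\mathbb R}$ denotes the Cauchy principal value at infinity, $\lim_{\rho\to\infty}\int_{-\mathrm i\rho}^{\mathrm i\rho}$. Subordination: $R$ is $p$-subordinate to $S$, $p\in[0,1]$, if $\mathcal D(S)\subset\mathcal D(R)$ and there is $c\ge0$ with $\|Rx\|\le c\|x\|^{1-p}\|Sx\|^p$ for all $x\in\mathcal D(S)$. Points of regular type: $r(S)$ (not to be confused with the radius $r$) is the set of $z\in\mathbb C$ for which there is $c>0$ with $\|(S-z)x\|\ge c\|x\|$ for all $x\in\mathcal D(S)$. Notation: $-\pi<\arg z\le\pi$, $\arg0=0$, $\Sigma_\theta=\{z\in\mathbb C:|\arg z|\le\theta\}$, $\Omega_{\theta',r}=\{z\in\mathbb C:\theta'\le|\arg z|\le\pi-\theta',\ |z|>r\}$. Bisectorial: a densely defined linear operator $S$ is bisectorial with angle $\theta\in[0,\pi/2[$ and radius $r\ge0$ if $\sigma(S)\subset\Sigma_\theta\cup(-\Sigma_\theta)\cup\{|z|\le r\}$ and for every $\theta'\in\,]\theta,\pi/2]$ there is $M>0$ with $\|(S-z)^{-1}\|\le M/|z|$ for all $z\in\Omega_{\theta',r}$; bisectorial with angle $\theta$ (no radius mentioned) means radius $r=0$. Dichotomous: a densely defined linear operator $S$ on $V$ is dichotomous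 if there exist $h>0$ and complementary closed subspaces $V=V_+\oplus V_-$ with (a) $\{z:|\operatorname{Re}z|<h\}\subset\varrho(S)$; (b) $S(\mathcal D(S)\cap V_\pm)\subset V_\pm$; (c) $\sigma(S|_{V_+})\subset\mathbb C_+$, $\sigma(S|_{V_-})\subset\mathbb C_-$. The maximal $h$ in (a) is the dichotomy gap; $P_\pm$ are the projections onto $V_\pm$ along $V_\mp$. *)

theory Defs
  imports "HOL-Analysis.Analysis"
begin

section \<open>Complex Banach spaces\<close>

class complex_normed_vector = real_normed_vector +
  fixes scaleC :: "complex \<Rightarrow> 'a \<Rightarrow> 'a" (infixr "*\<^sub>C" 75)
  assumes scaleC_add_right: "a *\<^sub>C (x + y) = a *\<^sub>C x + a *\<^sub>C y"
    and scaleC_add_left: "(a + b) *\<^sub>C x = a *\<^sub>C x + b *\<^sub>C x"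
    and scaleC_scaleC: "a *\<^sub>C (b *\<^sub>C x) = (a * b) *\<^sub>C x"
    and scaleR_scaleC: "t *\<^sub>R x = complex_of_real t *\<^sub>C x"
    and norm_scaleC: "norm (a *\<^sub>C x) = cmod a * norm x"

class complex_banach = complex_normed_vector + banach

abbreviation csubspace :: "'a::complex_normed_vector set \<Rightarrow> bool" where
  "csubspace \<equiv> module.subspace scaleC"


section \<open>Unbounded operators\<close>

text \<open>An operator is a domain together with a total function whose values outside the domain are
  irrelevant: every notion below uses the function on the domain only.\<close>

datatype 'a operator = Operator (op_dom: "'a set") (op_app: "'a \<Rightarrow> 'a")

definition linear_operator :: "'a::complex_normed_vector operator \<Rightarrow> bool" where
  "linear_operator S \<longleftrightarrow>
     csubspace (op_dom S) \<and>
     (\<forall>x\<in>op_dom S. \<forall>y\<in>op_dom S. op_app S (x + y) = op_app S x + op_app S y) \<and>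
     (\<forall>a. \<forall>x\<in>op_dom S. op_app S (a *\<^sub>C x) = a *\<^sub>C op_app S x)"

definition densely_defined :: "'a::complex_normed_vector operator \<Rightarrow> bool" where
  "densely_defined S \<longleftrightarrow> closure (op_dom S) = UNIV"

definition closed_operator :: "'a::complex_normed_vector operator \<Rightarrow> bool" where
  "closed_operator S \<longleftrightarrow> closed ((\<lambda>x. (x, op_app S x)) ` op_dom S)"

definition op_plus :: "'a::complex_normed_vector operator \<Rightarrow> 'a operator \<Rightarrow> 'a operator" where
  "op_plus S R = Operator (op_dom S \<inter> op_dom R) (\<lambda>x. op_app S x + op_app R x)"

text \<open>The part of an operator in a subspace; it acts in that subspace when the subspace is invariant.\<close>

definition op_restrict :: "'a::complex_normed_vector operator \<Rightarrow> 'a set \<Rightarrow> 'a operator" where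
  "op_restrict S W = Operator (op_dom S \<inter> W) (op_app S)"

definition resolvent :: "'a::complex_normed_vector operator \<Rightarrow> complex \<Rightarrow> 'a \<Rightarrow> 'a" where
  "resolvent S z = the_inv_into (op_dom S) (\<lambda>x. op_app S x - z *\<^sub>C x)"

text \<open>Resolvent set and spectrum of an operator acting in the space \<open>W\<close>; the ambient space is a
  parameter because restrictions to closed subspaces \<open>W\<close> are considered too. The inverse of
  \<open>S - z\<close> is required to be bounded (which is automatic if \<open>S\<close> is closed).\<close>

definition resolvent_set_in :: "'a::complex_normed_vector set \<Rightarrow> 'a operator \<Rightarrow> complex set" where
  "resolvent_set_in W S =
     {z. bij_betw (\<lambda>x. op_app S x - z *\<^sub>C x) (op_dom S) W \<and>
         (\<exists>C. \<forall>y\<in>W. norm (resolvent S z y) \<le> C * norm y)}"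

definition spectrum_in :: "'a::complex_normed_vector set \<Rightarrow> 'a operator \<Rightarrow> complex set" where
  "spectrum_in W S = - resolvent_set_in W S"

abbreviation resolvent_set :: "'a::complex_normed_vector operator \<Rightarrow> complex set" where
  "resolvent_set \<equiv> resolvent_set_in UNIV"

abbreviation spectrum :: "'a::complex_normed_vector operator \<Rightarrow> complex set" where
  "spectrum \<equiv> spectrum_in UNIV"

definition regular_points :: "'a::complex_normed_vector operator \<Rightarrow> complex set" where
  "regular_points S =
     {z. \<exists>c>0. \<forall>x\<in>op_dom S. norm (op_app S x - z *\<^sub>C x) \<ge> c * norm x}"


section \<open>Subordination\<close>

text \<open>The convention \<open>0\<^sup>0 = 1\<close> is needed for the exponents \<open>p = 0\<close> and \<open>p = 1\<close>; the library has
  \<open>0 powr 0 = 0\<close>.\<close>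

definition rpow :: "real \<Rightarrow> real \<Rightarrow> real" where
  "rpow a p = (if p = 0 then 1 else a powr p)"

definition p_subordinate ::
    "real \<Rightarrow> 'a::complex_normed_vector operator \<Rightarrow> 'a operator \<Rightarrow> bool" where
  "p_subordinate p R S \<longleftrightarrow>
     0 \<le> p \<and> p \<le> 1 \<and> op_dom S \<subseteq> op_dom R \<and>
     (\<exists>c\<ge>0. \<forall>x\<in>op_dom S.
        norm (op_app R x) \<le> c * rpow (norm x) (1 - p) * rpow (norm (op_app S x)) p)"


section \<open>Bisectorial operators\<close>

definition sector :: "real \<Rightarrow> complex set" where
  "sector \<theta> = {z. \<bar>Arg z\<bar> \<le> \<theta>}"

definition Omega :: "real \<Rightarrow> real \<Rightarrow> complex set" where
  "Omega \<theta>' r = {z. \<theta>' \<le> \<bar>Arg z\<bar> \<and> \<bar>Arg z\<bar> \<le> pi - \<theta>' \<and> cmod z > r}"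

text \<open>The spectral inclusion forces \<open>Omega \<theta>' r\<close> into the resolvent set for \<open>\<theta>' > \<theta>\<close>, so that
  \<open>onorm\<close> is applied to bounded linear operators only.\<close>

definition bisectorial :: "'a::complex_normed_vector operator \<Rightarrow> real \<Rightarrow> real \<Rightarrow> bool" where
  "bisectorial S \<theta> r \<longleftrightarrow>
     linear_operator S \<and> densely_defined S \<and> 0 \<le> \<theta> \<and> \<theta> < pi / 2 \<and> 0 \<le> r \<and>
     spectrum S \<subseteq> sector \<theta> \<union> uminus ` sector \<theta> \<union> {z. cmod z \<le> r} \<and>
     (\<forall>\<theta>'. \<theta> < \<theta>' \<and> \<theta>' \<le> pi / 2 \<longrightarrow>
        (\<exists>M>0. \<forall>z\<in>Omega \<theta>' r. onorm (resolvent S z) \<le> M / cmod z))"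


section \<open>Dichotomous operators\<close>

definition complementary :: "'a::complex_normed_vector set \<Rightarrow> 'a set \<Rightarrow> bool" where
  "complementary U W \<longleftrightarrow>
     csubspace U \<and> csubspace W \<and> closed U \<and> closed W \<and>
     U \<inter> W = {0} \<and> {u + w |u w. u \<in> U \<and> w \<in> W} = UNIV"

definition proj_along :: "'a::complex_normed_vector set \<Rightarrow> 'a set \<Rightarrow> 'a \<Rightarrow> 'a" where
  "proj_along U W x = (THE u. u \<in> U \<and> x - u \<in> W)"

text \<open>The decomposition is an explicit parameter, since in general a dichotomous operator does not
  determine it uniquely: an operator with empty spectrum may satisfy the conditions both with
  \<open>V\<^sub>- = 0\<close> and with \<open>V\<^sub>+ = 0\<close>.\<close>

definition dichotomous_wrt ::
    "'a::complex_normed_vector operator \<Rightarrow> 'a set \<Rightarrow> 'a set \<Rightarrow> bool" where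
  "dichotomous_wrt S Vp Vm \<longleftrightarrow>
     linear_operator S \<and> densely_defined S \<and> complementary Vp Vm \<and>
     (\<exists>h>0. {z. \<bar>Re z\<bar> < h} \<subseteq> resolvent_set S) \<and>
     op_app S ` (op_dom S \<inter> Vp) \<subseteq> Vp \<and> op_app S ` (op_dom S \<inter> Vm) \<subseteq> Vm \<and>
     spectrum_in Vp (op_restrict S Vp) \<subseteq> {z. Re z > 0} \<and>
     spectrum_in Vm (op_restrict S Vm) \<subseteq> {z. Re z < 0}"

text \<open>The gap is extended real since it is infinite when the spectrum is empty.\<close>

definition dichotomy_gap :: "'a::complex_normed_vector operator \<Rightarrow> ereal" where
  "dichotomy_gap S = Sup {ereal h |h. h > 0 \<and> {z. \<bar>Re z\<bar> < h} \<subseteq> resolvent_set S}"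


section \<open>Principal value integral along the imaginary axis\<close>

text \<open>With the parametrisation \<open>z = \<i> t\<close>, hence \<open>dz = \<i> dt\<close>.\<close>

definition has_pv_integral :: "(complex \<Rightarrow> 'a::complex_banach) \<Rightarrow> 'a \<Rightarrow> bool" where
  "has_pv_integral f I \<longleftrightarrow>
     (\<forall>\<rho>>0. (\<lambda>t. f (\<i> * complex_of_real t)) integrable_on {-\<rho>..\<rho>}) \<and>
     ((\<lambda>\<rho>. \<i> *\<^sub>C integral {-\<rho>..\<rho>} (\<lambda>t. f (\<i> * complex_of_real t))) \<longlongrightarrow> I) at_top"

end

theory Submission
  imports Defs "HOL-Real_Asymp.Real_Asymp"
begin

text \<open>Write \<open>T = S + R\<close> and \<open>R\<^sub>t = (T - it)\<^sup>-\<^sup>1\<close>. On a closed bisector outside a disc,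
  \<open>S (S - z)\<^sup>-\<^sup>1 = 1 + z (S - z)\<^sup>-\<^sup>1\<close> is bounded, so subordination with exponent \<open>p < 1\<close> gives
  \<open>R (S - z)\<^sup>-\<^sup>1 = O(|z|\<^sup>p\<^sup>-\<^sup>1)\<close> (\<open>subordinate_small_on_bisector\<close>). A Neumann argument then puts all
  large \<open>z\<close> of the bisector into the resolvent set of \<open>T\<close>, with the same kind of estimate
  (\<open>perturbed_bisector\<close>). In particular large points of the imaginary axis are resolvent points; as
  all its points are of regular type and the axis is connected, the whole axis consists of resolvent
  points (\<open>imaginary_axis_in_resolvent_set\<close>), and by compactness
  \<open>\<parallel>R\<^sub>t\<parallel> \<le> K / (1 + |t|)\<close> for some \<open>K\<close>. Shifting the spectral parameter horizontally by a small
  multiple of \<open>1 + |t|\<close> yields a strip and a full bisector around the axis without spectrum. Since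
  \<open>(S - it)\<^sup>-\<^sup>1 - R\<^sub>t = O(|t|\<^sup>p\<^sup>-\<^sup>2)\<close> is integrable at infinity, the principal value integral of \<open>R\<^sub>t x\<close>
  exists because that of \<open>(S - it)\<^sup>-\<^sup>1 x\<close> does.

  What remains is a statement about \<open>T\<close> alone: the operator \<open>Q x = (1 / \<pi>) \<integral>' R\<^sub>t x dt\<close>, the sign of
  \<open>T\<close>, is bounded by the uniform boundedness principle, and its eigenspaces for \<open>1\<close> and \<open>-1\<close> are the
  desired subspaces once \<open>Q\<^sup>2 = 1\<close> is known. Contour integration of operator valued functions is
  avoided as follows. With \<open>h(u) = (T\<^sup>2 + u)\<^sup>-\<^sup>1\<close> one has \<open>R\<^sub>t + R\<^sub>-\<^sub>t = 2 T h(t\<^sup>2)\<close>, so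
  \<open>Q = (2 / \<pi>) T J\<close> with \<open>J = \<integral>\<^sub>0\<^sup>\<infinity> h(t\<^sup>2) dt\<close>, and \<open>J\<close> is up to the factor \<open>\<pi> / 2\<close> an inverse square
  root of \<open>T\<^sup>2\<close>. The identity \<open>J\<^sup>2 = (\<pi>\<^sup>2 / 4) T\<^sup>-\<^sup>2\<close> only involves the real parameter \<open>u\<close> and follows
  from a linear differential equation in a shift of \<open>T\<^sup>2\<close> (\<open>inverse_sqrt_square\<close>); hence \<open>Q\<^sup>2 = 1\<close> on the
  dense range of \<open>T\<^sup>-\<^sup>2\<close>, and everywhere by continuity (\<open>sign_op_sign_op\<close>).

  Finally, for \<open>Re \<mu> \<noteq> 0\<close> the absolutely convergent integral of \<open>R\<^sub>t / (it - \<mu>)\<close> over the real line,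
  applied after \<open>T - \<mu>\<close>, equals \<open>\<pi> (Q - sgn (Re \<mu>))\<close>. On the eigenspace of \<open>Q\<close> for
  \<open>- sgn (Re \<mu>)\<close> this is a nonzero scalar, so there the integral inverts \<open>T - \<mu>\<close> up to that scalar,
  which locates the spectra of the two parts of \<open>T\<close>
  (\<open>resolvent_set_eigenspace_off_axis\<close>).\<close>

section \<open>Resolvents of unbounded operators\<close>

lemma module_scaleC:
  "module (scaleC :: complex \<Rightarrow> 'a::complex_normed_vector \<Rightarrow> 'a)"
proof
  show "1 *\<^sub>C x = x" for x :: 'a
    using scaleR_scaleC[of 1 x] by simp
qed (simp_all add: scaleC_add_right scaleC_add_left scaleC_scaleC)

interpretation scaleC: module "scaleC :: complex \<Rightarrow> 'a::complex_normed_vector \<Rightarrow> 'a"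
  by (rule module_scaleC)

lemma bounded_linear_scaleC: "bounded_linear (\<lambda>x::'a::complex_normed_vector. a *\<^sub>C x)"
  by (rule bounded_linear_intro[where K = "cmod a"])
    (simp_all add: scaleC_add_right scaleR_scaleC scaleC_scaleC mult.commute norm_scaleC)

lemma bounded_bilinear_scaleC:
  "bounded_bilinear (scaleC :: complex \<Rightarrow> 'a::complex_normed_vector \<Rightarrow> 'a)"
  by (rule bounded_bilinear.intro)
    (auto simp: scaleC_add_right scaleC_add_left scaleR_scaleC scaleC_scaleC scaleR_conv_of_real
      mult.commute norm_scaleC intro!: exI[of _ 1])

lemma linear_operatorD:
  assumes "linear_operator T"
  shows "0 \<in> op_dom T" and "op_app T 0 = 0"
    and "x \<in> op_dom T \<Longrightarrow> y \<in> op_dom T \<Longrightarrow> x + y \<in> op_dom T"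
    and "x \<in> op_dom T \<Longrightarrow> y \<in> op_dom T \<Longrightarrow> op_app T (x + y) = op_app T x + op_app T y"
    and "x \<in> op_dom T \<Longrightarrow> a *\<^sub>C x \<in> op_dom T"
    and "x \<in> op_dom T \<Longrightarrow> op_app T (a *\<^sub>C x) = a *\<^sub>C op_app T x"
    and "x \<in> op_dom T \<Longrightarrow> y \<in> op_dom T \<Longrightarrow> x - y \<in> op_dom T"
    and "x \<in> op_dom T \<Longrightarrow> y \<in> op_dom T \<Longrightarrow> op_app T (x - y) = op_app T x - op_app T y"
proof -
  have sub: "csubspace (op_dom T)"
    and add: "\<And>x y. x \<in> op_dom T \<Longrightarrow> y \<in> op_dom T \<Longrightarrow> op_app T (x + y) = op_app T x + op_app T y"
    and scale: "\<And>a x. x \<in> op_dom T \<Longrightarrow> op_app T (a *\<^sub>C x) = a *\<^sub>C op_app T x"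
    using assms by (auto simp: linear_operator_def)
  note d = scaleC.subspace_0[OF sub] scaleC.subspace_add[OF sub]
    scaleC.subspace_scale[OF sub] scaleC.subspace_diff[OF sub]
  show "0 \<in> op_dom T" "x \<in> op_dom T \<Longrightarrow> y \<in> op_dom T \<Longrightarrow> x + y \<in> op_dom T"
    "x \<in> op_dom T \<Longrightarrow> a *\<^sub>C x \<in> op_dom T"
    "x \<in> op_dom T \<Longrightarrow> y \<in> op_dom T \<Longrightarrow> x - y \<in> op_dom T"
    by (simp_all add: d)
  show "op_app T 0 = 0" using scale[OF d(1), of 0] by simp
  show "op_app T (x + y) = op_app T x + op_app T y" if "x \<in> op_dom T" "y \<in> op_dom T"
    using add that .
  show "op_app T (a *\<^sub>C x) = a *\<^sub>C op_app T x" if "x \<in> op_dom T" using scale that .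
  show "op_app T (x - y) = op_app T x - op_app T y" if "x \<in> op_dom T" "y \<in> op_dom T"
    using add[of "x - y" y] d(4) that by simp
qed

lemma shift_add:
  assumes "linear_operator T" "x \<in> op_dom T" "y \<in> op_dom T"
  shows "op_app T (x + y) - z *\<^sub>C (x + y) = (op_app T x - z *\<^sub>C x) + (op_app T y - z *\<^sub>C y)"
  using assms by (simp add: linear_operatorD scaleC_add_right)

lemma shift_diff:
  assumes "linear_operator T" "x \<in> op_dom T" "y \<in> op_dom T"
  shows "op_app T (x - y) - z *\<^sub>C (x - y) = (op_app T x - z *\<^sub>C x) - (op_app T y - z *\<^sub>C y)"
  using assms by (simp add: linear_operatorD scaleC.scale_right_diff_distrib)

lemma shift_scaleC:
  assumes "linear_operator T" "x \<in> op_dom T"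
  shows "op_app T (a *\<^sub>C x) - z *\<^sub>C (a *\<^sub>C x) = a *\<^sub>C (op_app T x - z *\<^sub>C x)"
  using assms
  by (simp add: linear_operatorD scaleC.scale_right_diff_distrib scaleC_scaleC mult.commute)

lemma op_dom_restrict [simp]: "op_dom (op_restrict T W) = op_dom T \<inter> W"
  and op_app_restrict [simp]: "op_app (op_restrict T W) = op_app T"
  by (simp_all add: op_restrict_def)

lemma linear_operator_restrict:
  "linear_operator T \<Longrightarrow> csubspace W \<Longrightarrow> linear_operator (op_restrict T W)"
  by (simp add: linear_operator_def scaleC.subspace_inter)

lemma resolvent_in_dom:
  assumes "z \<in> resolvent_set T"
  shows "resolvent T z y \<in> op_dom T"
proof -
  have b: "bij_betw (\<lambda>x. op_app T x - z *\<^sub>C x) (op_dom T) UNIV"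
    using assms by (simp add: resolvent_set_in_def)
  show ?thesis
    unfolding resolvent_def
    by (rule the_inv_into_into) (use b in \<open>auto simp: bij_betw_def\<close>)
qed

lemma resolvent_right:
  assumes "z \<in> resolvent_set T"
  shows "op_app T (resolvent T z y) - z *\<^sub>C resolvent T z y = y"
proof -
  have b: "bij_betw (\<lambda>x. op_app T x - z *\<^sub>C x) (op_dom T) UNIV"
    using assms by (simp add: resolvent_set_in_def)
  show ?thesis
    unfolding resolvent_def using f_the_inv_into_f_bij_betw[OF b, of y] by simp
qed

lemma resolvent_left:
  assumes "z \<in> resolvent_set T" "x \<in> op_dom T"
  shows "resolvent T z (op_app T x - z *\<^sub>C x) = x"
proof -
  have b: "bij_betw (\<lambda>x. op_app T x - z *\<^sub>C x) (op_dom T) UNIV"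
    using assms by (simp add: resolvent_set_in_def)
  show ?thesis
    unfolding resolvent_def
    using the_inv_into_f_f[of "\<lambda>x. op_app T x - z *\<^sub>C x" "op_dom T" x] b assms(2)
    by (simp add: bij_betw_def)
qed

lemma op_app_resolvent:
  assumes "z \<in> resolvent_set T"
  shows "op_app T (resolvent T z y) = y + z *\<^sub>C resolvent T z y"
  using resolvent_right[OF assms, of y] by (simp add: algebra_simps)

lemma resolvent_eqI:
  assumes "z \<in> resolvent_set T" "x \<in> op_dom T" "op_app T x - z *\<^sub>C x = y"
  shows "resolvent T z y = x"
  using resolvent_left[OF assms(1,2)] assms(3) by simp

lemma resolvent_scaleC:
  assumes "linear_operator T" "z \<in> resolvent_set T"
  shows "resolvent T z (a *\<^sub>C y) = a *\<^sub>C resolvent T z y"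
  by (rule resolvent_eqI)
    (simp_all only: assms linear_operatorD(5) resolvent_in_dom shift_scaleC resolvent_right)

lemma bounded_linear_resolvent:
  assumes "linear_operator T" "z \<in> resolvent_set T"
  shows "bounded_linear (resolvent T z)"
proof -
  obtain C where C: "\<And>y. norm (resolvent T z y) \<le> C * norm y"
    using assms(2) by (auto simp: resolvent_set_in_def)
  show ?thesis
  proof (rule bounded_linear_intro[where K = C])
    show "resolvent T z (x + y) = resolvent T z x + resolvent T z y" for x y
      by (rule resolvent_eqI)
        (simp_all add: assms linear_operatorD(3) resolvent_in_dom shift_add resolvent_right)
    show "resolvent T z (r *\<^sub>R x) = r *\<^sub>R resolvent T z x" for r x
      by (simp add: scaleR_scaleC resolvent_scaleC assms)
  qed (use C in \<open>simp add: mult.commute\<close>)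
qed

lemma resolvent_identity:
  assumes "linear_operator T" "z \<in> resolvent_set T" "w \<in> resolvent_set T"
  shows "resolvent T z y - resolvent T w y = (z - w) *\<^sub>C resolvent T z (resolvent T w y)"
proof -
  let ?u = "resolvent T w y"
  have "y = (op_app T ?u - z *\<^sub>C ?u) + (z - w) *\<^sub>C ?u"
    using resolvent_right[OF assms(3), of y]
    by (simp add: scaleC.scale_left_diff_distrib algebra_simps)
  then have "resolvent T z y
      = resolvent T z (op_app T ?u - z *\<^sub>C ?u) + resolvent T z ((z - w) *\<^sub>C ?u)"
    using linear_add[OF bounded_linear.linear[OF bounded_linear_resolvent[OF assms(1,2)]]]
    by metis
  then show ?thesis
    by (simp add: resolvent_left assms resolvent_in_dom resolvent_scaleC)
qed

lemma resolvent_commute: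
  assumes "linear_operator T" "z \<in> resolvent_set T" "w \<in> resolvent_set T"
  shows "resolvent T z (resolvent T w y) = resolvent T w (resolvent T z y)"
proof (cases "z = w")
  case False
  have "(z - w) *\<^sub>C resolvent T z (resolvent T w y) = (z - w) *\<^sub>C resolvent T w (resolvent T z y)"
    using resolvent_identity[OF assms, of y] resolvent_identity[OF assms(1,3,2), of y]
    by (metis minus_diff_eq scaleC.scale_minus_left)
  then have "(1 / (z - w)) *\<^sub>C ((z - w) *\<^sub>C resolvent T z (resolvent T w y))
      = (1 / (z - w)) *\<^sub>C ((z - w) *\<^sub>C resolvent T w (resolvent T z y))" by simp
  with False show ?thesis by (simp add: scaleC_scaleC del: scaleC.scale_right_diff_distrib)
qed simp

text \<open>Injectivity and the bound on the inverse both follow from one lower estimate, which is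
  therefore the form in which all resolvent bounds are carried along.\<close>

definition bounded_below :: "'a::complex_normed_vector operator \<Rightarrow> complex \<Rightarrow> real \<Rightarrow> bool" where
  "bounded_below T z m \<longleftrightarrow> (\<forall>x\<in>op_dom T. norm x \<le> m * norm (op_app T x - z *\<^sub>C x))"

lemma resolvent_set_inI:
  assumes lin: "linear_operator T"
    and bd: "bounded_below T z m"
    and maps: "\<And>x. x \<in> op_dom T \<Longrightarrow> op_app T x - z *\<^sub>C x \<in> W"
    and surj: "\<And>y. y \<in> W \<Longrightarrow> \<exists>x\<in>op_dom T. op_app T x - z *\<^sub>C x = y"
  shows "z \<in> resolvent_set_in W T"
proof -
  have inj: "inj_on (\<lambda>x. op_app T x - z *\<^sub>C x) (op_dom T)"
  proof (rule inj_onI)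
    fix x y assume "x \<in> op_dom T" "y \<in> op_dom T"
      and "op_app T x - z *\<^sub>C x = op_app T y - z *\<^sub>C y"
    then have "x - y \<in> op_dom T" "op_app T (x - y) - z *\<^sub>C (x - y) = 0"
      using linear_operatorD(7)[OF lin] shift_diff[OF lin] by auto
    then show "x = y" using bd by (force simp: bounded_below_def)
  qed
  have "norm (resolvent T z y) \<le> m * norm y" if "y \<in> W" for y
  proof -
    obtain x where x: "x \<in> op_dom T" "op_app T x - z *\<^sub>C x = y" using surj[OF \<open>y \<in> W\<close>] by blast
    then have "resolvent T z y = x"
      unfolding resolvent_def using the_inv_into_f_f[OF inj x(1)] by simp
    then show ?thesis using bd x by (auto simp: bounded_below_def)
  qed
  then show ?thesis
    using inj maps surj by (force simp: resolvent_set_in_def bij_betw_def)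
qed

lemma norm_resolvent_le:
  assumes "z \<in> resolvent_set T" "bounded_below T z m"
  shows "norm (resolvent T z y) \<le> m * norm y"
  using assms(2) resolvent_in_dom[OF assms(1), of y] resolvent_right[OF assms(1), of y]
  unfolding bounded_below_def by force

lemma bounded_below_mono: "bounded_below T z m \<Longrightarrow> m \<le> m' \<Longrightarrow> bounded_below T z m'"
  unfolding bounded_below_def by (meson dual_order.trans mult_right_mono norm_ge_zero)

lemma bounded_belowI_onorm:
  assumes "linear_operator T" "z \<in> resolvent_set T" "onorm (resolvent T z) \<le> m"
  shows "bounded_below T z m"
  unfolding bounded_below_def
proof
  fix x assume x: "x \<in> op_dom T"
  have "norm (resolvent T z (op_app T x - z *\<^sub>C x))
      \<le> onorm (resolvent T z) * norm (op_app T x - z *\<^sub>C x)"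
    using onorm[OF bounded_linear_resolvent[OF assms(1,2)]] by blast
  also have "\<dots> \<le> m * norm (op_app T x - z *\<^sub>C x)" using assms(3) by (simp add: mult_right_mono)
  finally show "norm x \<le> m * norm (op_app T x - z *\<^sub>C x)"
    by (simp add: resolvent_left assms x)
qed

text \<open>If \<open>T' - w = (T - z) + B\<close> and \<open>B\<close> composed with the resolvent of \<open>T\<close> at \<open>z\<close> has norm at most
  \<open>q < 1\<close>, then \<open>T' - w\<close> is \<open>T - z\<close> followed by a perturbation of the identity that a contraction
  argument inverts. Both perturbations of the operator and shifts of the spectral parameter are of
  this form.\<close>

lemma resolvent_set_perturb:
  fixes T T' :: "'a::complex_banach operator"
  assumes lin: "linear_operator T" "linear_operator T'" and dom: "op_dom T' = op_dom T"
    and z: "z \<in> resolvent_set T" and bd: "bounded_below T z m"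
    and small: "\<And>x. x \<in> op_dom T \<Longrightarrow>
      norm ((op_app T' x - w *\<^sub>C x) - (op_app T x - z *\<^sub>C x)) \<le> q * norm (op_app T x - z *\<^sub>C x)"
    and q: "0 \<le> q" "q < 1" and m: "0 \<le> m"
  shows "w \<in> resolvent_set T'" and "bounded_below T' w (m / (1 - q))"
proof -
  define A A' where "A = (\<lambda>x. op_app T x - z *\<^sub>C x)" and "A' = (\<lambda>x. op_app T' x - w *\<^sub>C x)"
  show bd': "bounded_below T' w (m / (1 - q))"
    unfolding bounded_below_def
  proof
    fix x assume "x \<in> op_dom T'"
    then have x: "x \<in> op_dom T" by (simp add: dom)
    have "norm (A x) \<le> norm (A' x) + norm (A' x - A x)"
      by (metis add.commute norm_triangle_sub norm_minus_commute)
    also have "norm (A' x - A x) \<le> q * norm (A x)" using small[OF x] by (simp add: A_def A'_def)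
    finally have "norm (A x) \<le> norm (A' x) / (1 - q)" using q by (simp add: field_simps)
    then have "m * norm (A x) \<le> m * (norm (A' x) / (1 - q))" using m by (rule mult_left_mono)
    moreover have "norm x \<le> m * norm (A x)" using bd x by (simp add: bounded_below_def A_def)
    ultimately show "norm x \<le> m / (1 - q) * norm (op_app T' x - w *\<^sub>C x)" by (simp add: A'_def)
  qed
  show "w \<in> resolvent_set T'"
  proof (rule resolvent_set_inI[OF lin(2) bd'])
    fix y :: 'a
    define g where "g v = y - (A' (resolvent T z v) - A (resolvent T z v))" for v
    have A_res: "A (resolvent T z v) = v" for v by (simp add: A_def resolvent_right z)
    note blr = bounded_linear.linear[OF bounded_linear_resolvent[OF lin(1) z]]
    have "dist (g u) (g v) \<le> q * dist u v" for u v
    proof -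
      let ?x = "resolvent T z (u - v)"
      have r: "resolvent T z u \<in> op_dom T" "resolvent T z v \<in> op_dom T" "?x \<in> op_dom T"
        by (simp_all add: resolvent_in_dom z)
      have "A' ?x = A' (resolvent T z u) - A' (resolvent T z v)"
        unfolding A'_def linear_diff[OF blr] by (rule shift_diff) (simp_all add: lin dom r)
      moreover have "A ?x = A (resolvent T z u) - A (resolvent T z v)"
        by (simp add: A_res)
      ultimately have "g u - g v = - (A' ?x - A ?x)" by (simp add: g_def algebra_simps)
      then have "norm (g u - g v) = norm (A' ?x - A ?x)" by (simp only: norm_minus_cancel)
      also have "\<dots> \<le> q * norm (A ?x)" using small[OF r(3)] by (simp add: A_def A'_def)
      finally show ?thesis by (simp add: A_res dist_norm)
    qed
    \<comment> \<open>A fixed point \<open>v\<close> of \<open>g\<close> solves \<open>v + B (T - z)\<^sup>-\<^sup>1 v = y\<close>.\<close>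
    then obtain v where "g v = v" using banach_fix_type[OF q, of g] by blast
    then have "A' (resolvent T z v) = y" by (simp add: g_def A_res algebra_simps)
    then show "\<exists>x\<in>op_dom T'. op_app T' x - w *\<^sub>C x = y"
      using resolvent_in_dom[OF z] by (auto simp: A'_def dom)
  qed simp
qed

section \<open>Improper integrals\<close>

lemma convergent_at_top_if_tails_vanish:
  fixes F :: "real \<Rightarrow> 'a::banach"
  assumes tail: "\<And>a b. a0 \<le> a \<Longrightarrow> a \<le> b \<Longrightarrow> norm (F b - F a) \<le> E a"
    and E: "(E \<longlongrightarrow> 0) at_top"
  shows "\<exists>L. (F \<longlongrightarrow> L) at_top"
proof -
  have seq: "(\<lambda>n. E (real n)) \<longlonglongrightarrow> 0"
    using E filterlim_real_sequentially by (rule filterlim_compose)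
  have "Cauchy (\<lambda>n. F (real n))"
  proof (rule metric_CauchyI)
    fix e :: real assume "0 < e"
    then have "\<forall>\<^sub>F n in sequentially. E (real n) < e / 2"
      using order_tendstoD(2)[OF seq, of "e / 2"] by simp
    moreover have "\<forall>\<^sub>F n in sequentially. a0 \<le> real n"
      using filterlim_real_sequentially by (simp add: filterlim_at_top)
    ultimately obtain M where M: "E (real M) < e / 2" "a0 \<le> real M"
      by (metis (mono_tags, lifting) eventually_conj_iff eventually_sequentially order_refl)
    have "dist (F (real m)) (F (real n)) < e" if "m \<ge> M" "n \<ge> M" for m n
    proof -
      have "dist (F (real m)) (F (real M)) < e / 2" "dist (F (real n)) (F (real M)) < e / 2"
        using tail[of "real M" "real m"] tail[of "real M" "real n"] M that
        by (auto simp: dist_norm)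
      then show ?thesis by (rule dist_triangle_half_l)
    qed
    then show "\<exists>M. \<forall>m\<ge>M. \<forall>n\<ge>M. dist (F (real m)) (F (real n)) < e" by blast
  qed
  then obtain L where L: "(\<lambda>n. F (real n)) \<longlonglongrightarrow> L"
    using Cauchy_convergent convergent_def by blast
  have "norm (F a - L) \<le> E a" if "a0 \<le> a" for a
  proof (rule tendsto_upperbound)
    show "(\<lambda>n. norm (F a - F (real n))) \<longlonglongrightarrow> norm (F a - L)" by (intro tendsto_intros L)
    have "\<forall>\<^sub>F n in sequentially. a \<le> real n"
      using filterlim_real_sequentially by (simp add: filterlim_at_top)
    then show "\<forall>\<^sub>F n in sequentially. norm (F a - F (real n)) \<le> E a"
      proof eventually_elim
      case (elim n)
      show ?case using tail[OF that elim] by (simp add: norm_minus_commute)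
    qed
  qed simp
  then have "((\<lambda>a. F a - L) \<longlongrightarrow> 0) at_top"
    by (intro Lim_null_comparison[OF _ E]) (auto simp: eventually_at_top_linorder)
  then show ?thesis using LIM_zero_cancel by blast
qed

lemma improper_integral_power_decay:
  fixes g :: "real \<Rightarrow> 'a::banach"
  assumes int: "\<And>a b. 0 \<le> a \<Longrightarrow> g integrable_on {a..b}"
    and bd: "\<And>t. a0 \<le> t \<Longrightarrow> norm (g t) \<le> C * t powr (- q)"
    and a0: "0 < a0" and q: "1 < q"
  shows "\<exists>L. ((\<lambda>N. integral {0..N} g) \<longlongrightarrow> L) at_top"
proof (rule convergent_at_top_if_tails_vanish)
  have C: "0 \<le> C" using bd[of a0] a0 norm_ge_zero[of "g a0"]
    by (smt (verit) mult_neg_pos powr_gt_zero)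
  fix a b assume ab: "a0 \<le> a" "a \<le> b"
  have a: "0 < a" using a0 ab by simp
  have I: "((\<lambda>t. C * t powr (- q)) has_integral
      C * (b powr (1 - q) / (1 - q)) - C * (a powr (1 - q) / (1 - q))) {a..b}"
  proof (rule fundamental_theorem_of_calculus[OF ab(2)])
    fix t assume "t \<in> {a..b}"
    then have "0 < t" using a by simp
    then have "((\<lambda>t. C * (t powr (1 - q) / (1 - q))) has_real_derivative C * t powr (- q)) (at t within {a..b})"
      using q by (auto intro!: derivative_eq_intros)
    then show "((\<lambda>t. C * (t powr (1 - q) / (1 - q))) has_vector_derivative C * t powr (- q)) (at t within {a..b})"
      by (simp add: has_real_derivative_iff_has_vector_derivative)
  qed
  have "integral {0..b} g - integral {0..a} g = integral {a..b} g"
    using Henstock_Kurzweil_Integration.integral_combine[of 0 a b g] a ab int[of 0 b]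
    by (simp add: algebra_simps)
  also have "norm \<dots> \<le> integral {a..b} (\<lambda>t. C * t powr (- q))"
    by (rule Henstock_Kurzweil_Integration.integral_norm_bound_integral) (use int a ab bd I in \<open>auto\<close>)
  also have "\<dots> = C * (b powr (1 - q) / (1 - q)) - C * (a powr (1 - q) / (1 - q))"
    using I by (rule integral_unique)
  also have "\<dots> \<le> C / (q - 1) * a powr (1 - q)"
  proof -
    have "0 \<le> C * (b powr (1 - q) / (q - 1))" using C q by simp
    moreover have "x / (1 - q) = - (x / (q - 1))" for x
      using q by (metis minus_diff_eq minus_divide_right)
    ultimately show ?thesis by simp
  qed
  finally show "norm (integral {0..b} g - integral {0..a} g) \<le> C / (q - 1) * a powr (1 - q)" .
next
  have "((\<lambda>a. a powr (1 - q)) \<longlongrightarrow> 0) at_top"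
    using q by (intro tendsto_neg_powr filterlim_ident) auto
  then show "((\<lambda>a. C / (q - 1) * a powr (1 - q)) \<longlongrightarrow> 0) at_top"
    by (rule tendsto_mult_right_zero)
qed

lemma integral_inverse_sum_squares:
  assumes "0 < s" "0 \<le> N"
  shows "((\<lambda>t. 1 / (s + t\<^sup>2)) has_integral arctan (N / sqrt s) / sqrt s) {0..N}"
proof -
  have "((\<lambda>t. 1 / (s + t\<^sup>2)) has_integral arctan (N / sqrt s) / sqrt s - arctan (0 / sqrt s) / sqrt s) {0..N}"
  proof (rule fundamental_theorem_of_calculus[OF assms(2)])
    fix t assume "t \<in> {0..N}"
    have "inverse (1 + (t / sqrt s)\<^sup>2) * (1 / sqrt s) / sqrt s
        = inverse (1 + t\<^sup>2 / s) / (sqrt s * sqrt s)"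
      using assms by (simp add: power_divide del: real_sqrt_mult_self)
    also have "\<dots> = 1 / (s + t\<^sup>2)"
      using assms by (simp add: divide_simps add_nonneg_eq_0_iff)
    finally have "1 / (s + t\<^sup>2) = inverse (1 + (t / sqrt s)\<^sup>2) * (1 / sqrt s) / sqrt s" ..
    moreover have "((\<lambda>t. arctan (t / sqrt s) / sqrt s) has_real_derivative
        inverse (1 + (t / sqrt s)\<^sup>2) * (1 / sqrt s) / sqrt s) (at t within {0..N})"
      using assms by (intro DERIV_cdivide DERIV_chain2[OF DERIV_arctan] DERIV_ident)
    ultimately show "((\<lambda>t. arctan (t / sqrt s) / sqrt s) has_vector_derivative 1 / (s + t\<^sup>2)) (at t within {0..N})"
      by (simp add: has_real_derivative_iff_has_vector_derivative)
  qed
  then show ?thesis by simp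
qed

lemma norm_integral_le_arctan:
  fixes g :: "real \<Rightarrow> 'a::banach"
  assumes g: "g integrable_on {0..N}" and bd: "\<And>t. 0 \<le> t \<Longrightarrow> norm (g t) \<le> C / (s + t\<^sup>2)"
    and s: "0 < s" and N: "0 \<le> N"
  shows "norm (integral {0..N} g) \<le> C * (pi / 2) / sqrt s"
proof -
  have "0 \<le> C" using order_trans[OF norm_ge_zero bd[of 0]] s by (simp add: zero_le_divide_iff)
  have "((\<lambda>t. C * (1 / (s + t\<^sup>2))) has_integral C * (arctan (N / sqrt s) / sqrt s)) {0..N}"
    by (intro has_integral_mult_right integral_inverse_sum_squares s N)
  then have I: "((\<lambda>t. C / (s + t\<^sup>2)) has_integral C * (arctan (N / sqrt s) / sqrt s)) {0..N}"
    by simp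
  have "norm (integral {0..N} g) \<le> integral {0..N} (\<lambda>t. C / (s + t\<^sup>2))"
    by (rule Henstock_Kurzweil_Integration.integral_norm_bound_integral) (use g bd I in auto)
  also have "\<dots> = C * (arctan (N / sqrt s) / sqrt s)" using I by (rule integral_unique)
  also have "\<dots> \<le> C * ((pi / 2) / sqrt s)"
    using \<open>0 \<le> C\<close> s arctan_ubound[of "N / sqrt s"]
    by (intro mult_left_mono divide_right_mono) (auto intro: less_imp_le)
  finally show ?thesis by simp
qed

text \<open>Symmetric truncation is what the principal value prescribes; folding the two half lines turns it
  into one improper integral over \<open>[0, \<infinity>)\<close>.\<close>

lemma integral_symmetric_interval:
  fixes f :: "real \<Rightarrow> 'a::banach"
  assumes f: "f integrable_on {-N..N}" and "0 \<le> N"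
  shows "integral {-N..N} f = integral {0..N} (\<lambda>t. f t + f (- t))"
proof -
  have neg: "f integrable_on {-N..0}" and pos: "f integrable_on {0..N}"
    using assms(2) by (auto intro: integrable_on_subinterval[OF f])
  have refl: "(\<lambda>t. f (- t)) integrable_on {0..N}"
    using neg Henstock_Kurzweil_Integration.integrable_reflect_real[of "\<lambda>t. f (- t)" N 0] by simp
  have "integral {-N..N} f = integral {-N..0} f + integral {0..N} f"
    using Henstock_Kurzweil_Integration.integral_combine[of "- N" 0 N f] assms by simp
  also have "integral {-N..0} f = integral {0..N} (\<lambda>t. f (- t))"
    using Henstock_Kurzweil_Integration.integral_reflect_real[of N 0 "\<lambda>t. f (- t)"] by simp
  finally show ?thesis
    by (simp add: Henstock_Kurzweil_Integration.integral_add refl pos add.commute)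
qed

section \<open>The square of the inverse square root\<close>

interpretation blinfun_comp: bounded_bilinear "(o\<^sub>L)"
  by (rule bounded_bilinear_blinfun_compose)

lemma blinfun_compose_assoc: "(a o\<^sub>L b) o\<^sub>L c = a o\<^sub>L (b o\<^sub>L c)"
  by (rule blinfun_eqI) simp

text \<open>The family \<open>h\<close> behaves like \<open>h(u) = (A + u)\<^sup>-\<^sup>1\<close>, and \<open>J\<close> like \<open>(\<pi> / 2) A\<^sup>-\<^sup>1\<^sup>/\<^sup>2\<close>. Put
  \<open>J(s) = \<integral>\<^sub>0\<^sup>\<infinity> h(s + t\<^sup>2) dt\<close>. Since \<open>h' = - h\<^sup>2\<close>, an integration by parts gives
  \<open>J'(s) = - (1 / 2) h(s) J(s)\<close>, so \<open>(A + s) J(s)\<^sup>2\<close> is constant; for large \<open>s\<close> the operator \<open>A\<close> is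
  negligible against \<open>s\<close> and the constant is found to be \<open>\<pi>\<^sup>2 / 4\<close>. Two measures keep the argument
  elementary: \<open>(A + s) J(s)\<^sup>2\<close> is multiplied by \<open>h(0)\<close>, so that only bounded operators occur, and the
  differential equation is derived for the integral truncated at \<open>N\<close>, where the boundary term of the
  integration by parts leaves an error of order \<open>1 / N\<close>.\<close>

lemma inverse_sqrt_square:
  fixes h :: "real \<Rightarrow> 'a::banach \<Rightarrow>\<^sub>L 'a"
  assumes resid: "\<And>u v. 0 \<le> u \<Longrightarrow> 0 \<le> v \<Longrightarrow> h u - h v = (v - u) *\<^sub>R (h u o\<^sub>L h v)"
    and bd: "\<And>u. 0 \<le> u \<Longrightarrow> norm (h u) \<le> C / (1 + u)"
    and J: "((\<lambda>N. integral {0..N} (\<lambda>t. h (t\<^sup>2))) \<longlongrightarrow> J) at_top"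
  shows "J o\<^sub>L J = (pi\<^sup>2 / 4) *\<^sub>R h 0"
proof -
  note bil = blinfun_comp.add_left blinfun_comp.add_right blinfun_comp.diff_left
    blinfun_comp.diff_right blinfun_comp.minus_left blinfun_comp.minus_right
    blinfun_comp.scaleR_left blinfun_comp.scaleR_right blinfun_compose_assoc
  have C: "0 \<le> C" using order_trans[OF norm_ge_zero bd[of 0]] by simp
  have bd1: "norm (h u) \<le> C" if "0 \<le> u" for u
    using bd[OF that] that C by (smt (verit) divide_le_eq_1 frac_le div_by_1)
  have comm: "h u o\<^sub>L h v = h v o\<^sub>L h u" if "0 \<le> u" "0 \<le> v" for u v
  proof (cases "u = v")
    case False
    have "(v - u) *\<^sub>R (h u o\<^sub>L h v) = (v - u) *\<^sub>R (h v o\<^sub>L h u)"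
      using resid[OF that] resid[OF that(2,1)]
      by (metis minus_diff_eq scaleR_minus_left)
    with False show ?thesis by simp
  qed simp
  have lip: "norm (h v - h u) \<le> \<bar>v - u\<bar> * (C * C)" if "0 \<le> u" "0 \<le> v" for u v
  proof -
    have "norm (h v o\<^sub>L h u) \<le> C * C"
      using norm_blinfun_compose[of "h v" "h u"] bd1[OF that(1)] bd1[OF that(2)]
      by (meson C mult_mono norm_ge_zero order_trans)
    then show ?thesis
      using resid[OF that(2,1)] by (simp add: abs_minus_commute mult_left_mono)
  qed
  have hcont: "continuous_on {0..} h"
  proof (rule lipschitz_on_continuous_on)
    show "(C * C)-lipschitz_on {0..} h"
      using lip by (intro lipschitz_onI) (auto simp: dist_norm dist_real_def mult.commute)
  qed
  have hder: "(h has_vector_derivative - (h u o\<^sub>L h u)) (at u within {0..})" if "0 \<le> u" for u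
    unfolding has_vector_derivative_def
  proof (rule has_derivativeI_sandwich[where e = 1 and H = "\<lambda>v. \<bar>v - u\<bar> * (C * C * C)"])
    fix v :: real assume v: "v \<in> {0..}" "v \<noteq> u"
    have "h v - h u = - ((v - u) *\<^sub>R (h v o\<^sub>L h u))"
      using resid[of v u] that v by (simp flip: scaleR_minus_left)
    moreover have "(h v - h u) o\<^sub>L h u = (h v o\<^sub>L h u) - (h u o\<^sub>L h u)"
      by (rule blinfun_comp.diff_left)
    ultimately have "h v - h u - (v - u) *\<^sub>R - (h u o\<^sub>L h u) = - ((v - u) *\<^sub>R ((h v - h u) o\<^sub>L h u))"
      by (simp only: scaleR_diff_right scaleR_minus_right) simp
    also have "norm \<dots> \<le> \<bar>v - u\<bar> * ((\<bar>v - u\<bar> * (C * C)) * C)"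
      unfolding norm_minus_cancel norm_scaleR
      by (intro mult_left_mono order_trans[OF norm_blinfun_compose] mult_mono lip bd1)
        (use that v C in auto)
    finally show "norm (h v - h u - (v - u) *\<^sub>R - (h u o\<^sub>L h u)) / norm (v - u) \<le> \<bar>v - u\<bar> * (C * C * C)"
      using v by (simp add: field_simps)
  next
    have "((\<lambda>v. \<bar>v - u\<bar> * (C * C * C)) \<longlongrightarrow> \<bar>u - u\<bar> * (C * C * C)) (at u within {0..})"
      by (intro tendsto_intros)
    then show "((\<lambda>v. \<bar>v - u\<bar> * (C * C * C)) \<longlongrightarrow> 0) (at u within {0..})" by simp
  qed (simp_all only: bounded_linear_scaleR_left zero_less_one)

  \<comment> \<open>\<open>G\<close> is the truncation of \<open>J(s)\<close>, \<open>D\<close> its negative derivative in \<open>s\<close>, and \<open>E\<close> the boundary term of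
    the integration by parts.\<close>
  define G where "G N s = integral {0..N} (\<lambda>t. h (s + t\<^sup>2))" for N s
  define D where "D N s = integral {0..N} (\<lambda>t. h (s + t\<^sup>2) o\<^sub>L h (s + t\<^sup>2))" for N s
  define E where "E N s = N *\<^sub>R h (s + N\<^sup>2)" for N s
  have c1: "continuous_on X (\<lambda>t. h (s + t\<^sup>2))" if "0 \<le> s" for s and X :: "real set"
    by (rule continuous_on_compose2[OF hcont]) (auto intro!: continuous_intros simp: that)
  have i1: "(\<lambda>t. h (s + t\<^sup>2)) integrable_on {a..b}" if "0 \<le> s" for s a b
    by (intro integrable_continuous_interval c1 that)
  have i2: "(\<lambda>t. h (s + t\<^sup>2) o\<^sub>L h (s + t\<^sup>2)) integrable_on {a..b}" if "0 \<le> s" for s a b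
    by (intro integrable_continuous_interval continuous_intros c1 that)
  have Gcomm: "G N s o\<^sub>L h u = h u o\<^sub>L G N s" if "0 \<le> s" "0 \<le> u" for N s u
  proof -
    have "G N s o\<^sub>L h u = integral {0..N} (\<lambda>t. h (s + t\<^sup>2) o\<^sub>L h u)"
      unfolding G_def
      using integral_linear[OF i1[OF that(1)] blinfun_comp.bounded_linear_left[of "h u"]]
      by (simp add: o_def)
    also have "\<dots> = integral {0..N} (\<lambda>t. h u o\<^sub>L h (s + t\<^sup>2))"
      using that by (simp add: comm)
    also have "\<dots> = h u o\<^sub>L G N s"
      unfolding G_def
      using integral_linear[OF i1[OF that(1)] blinfun_comp.bounded_linear_right[of "h u"]]
      by (simp add: o_def)
    finally show ?thesis .
  qed
  have Gder: "(G N has_vector_derivative - D N s) (at s within {0..})" if "0 \<le> s" for N s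
  proof -
    have "((\<lambda>s. integral (cbox 0 N) (\<lambda>t. h (s + t\<^sup>2))) has_vector_derivative
        integral (cbox 0 N) (\<lambda>t. - (h (s + t\<^sup>2) o\<^sub>L h (s + t\<^sup>2)))) (at s within {0..})"
    proof (rule leibniz_rule_vector_derivative)
      show "((\<lambda>s. h (s + t\<^sup>2)) has_vector_derivative - (h (x + t\<^sup>2) o\<^sub>L h (x + t\<^sup>2))) (at x within {0..})"
        if "x \<in> {0..}" for x t
      proof -
        have "((h \<circ> (\<lambda>s. s + t\<^sup>2)) has_vector_derivative 1 *\<^sub>R - (h (x + t\<^sup>2) o\<^sub>L h (x + t\<^sup>2))) (at x within {0..})"
        proof (rule vector_diff_chain_within)
          show "((\<lambda>s. s + t\<^sup>2) has_vector_derivative 1) (at x within {0..})"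
            by (auto intro!: derivative_eq_intros)
          show "(h has_vector_derivative - (h (x + t\<^sup>2) o\<^sub>L h (x + t\<^sup>2)))
              (at (x + t\<^sup>2) within (\<lambda>s. s + t\<^sup>2) ` {0..})"
            by (rule has_vector_derivative_within_subset[OF hder]) (use that in auto)
        qed
        then show ?thesis by (simp add: o_def)
      qed
      show "continuous_on ({0..} \<times> cbox 0 N) (\<lambda>(x, t). - (h (x + t\<^sup>2) o\<^sub>L h (x + t\<^sup>2)))"
        unfolding split_beta
        by (intro continuous_intros continuous_on_compose2[OF hcont]) auto
    qed (use i1 that in auto)
    then show ?thesis by (simp add: G_def[abs_def] D_def)
  qed
  \<comment> \<open>Integration by parts with the antiderivative \<open>t h(s + t\<^sup>2)\<close>.\<close>
  have D_eq: "2 *\<^sub>R D N s = h s o\<^sub>L (G N s + E N s)" if s: "0 \<le> s" and N: "0 \<le> N" for N s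
  proof -
    have "((\<lambda>t. h (s + t\<^sup>2) - (2 * t\<^sup>2) *\<^sub>R (h (s + t\<^sup>2) o\<^sub>L h (s + t\<^sup>2))) has_integral
        N *\<^sub>R h (s + N\<^sup>2) - 0 *\<^sub>R h (s + 0\<^sup>2)) {0..N}"
    proof (rule fundamental_theorem_of_calculus[OF N])
      fix t assume "t \<in> {0..N}"
      have "((h \<circ> (\<lambda>t. s + t\<^sup>2)) has_vector_derivative (2 * t) *\<^sub>R - (h (s + t\<^sup>2) o\<^sub>L h (s + t\<^sup>2))) (at t within {0..N})"
      proof (rule vector_diff_chain_within)
        show "((\<lambda>t. s + t\<^sup>2) has_vector_derivative 2 * t) (at t within {0..N})"
          unfolding has_real_derivative_iff_has_vector_derivative[symmetric]
          by (auto intro!: derivative_eq_intros)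
        show "(h has_vector_derivative - (h (s + t\<^sup>2) o\<^sub>L h (s + t\<^sup>2)))
            (at (s + t\<^sup>2) within (\<lambda>t. s + t\<^sup>2) ` {0..N})"
          by (rule has_vector_derivative_within_subset[OF hder]) (use s in auto)
      qed
      from has_vector_derivative_scaleR[OF DERIV_ident this]
      have "((\<lambda>t. t *\<^sub>R h (s + t\<^sup>2)) has_vector_derivative
          t *\<^sub>R (2 * t) *\<^sub>R - (h (s + t\<^sup>2) o\<^sub>L h (s + t\<^sup>2)) + 1 *\<^sub>R h (s + t\<^sup>2)) (at t within {0..N})"
        by (simp add: o_def)
      then show "((\<lambda>t. t *\<^sub>R h (s + t\<^sup>2)) has_vector_derivative
          h (s + t\<^sup>2) - (2 * t\<^sup>2) *\<^sub>R (h (s + t\<^sup>2) o\<^sub>L h (s + t\<^sup>2))) (at t within {0..N})"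
        by (simp add: power2_eq_square algebra_simps)
    qed
    then have "((\<lambda>t. h s o\<^sub>L (h (s + t\<^sup>2) - (2 * t\<^sup>2) *\<^sub>R (h (s + t\<^sup>2) o\<^sub>L h (s + t\<^sup>2)))) has_integral
        h s o\<^sub>L E N s) {0..N}"
      using has_integral_linear[OF _ blinfun_comp.bounded_linear_right[of "h s"]]
      by (simp only: E_def o_def scaleR_zero_left diff_zero)
    moreover have "h s o\<^sub>L (h (s + t\<^sup>2) - (2 * t\<^sup>2) *\<^sub>R (h (s + t\<^sup>2) o\<^sub>L h (s + t\<^sup>2)))
        = 2 *\<^sub>R (h (s + t\<^sup>2) o\<^sub>L h (s + t\<^sup>2)) - (h s o\<^sub>L h (s + t\<^sup>2))" for t
    proof -
      let ?k = "h (s + t\<^sup>2)"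
      have "t\<^sup>2 *\<^sub>R (h s o\<^sub>L ?k) = h s - ?k" using resid[of s "s + t\<^sup>2"] s by simp
      then have "t\<^sup>2 *\<^sub>R (h s o\<^sub>L (?k o\<^sub>L ?k)) = (h s - ?k) o\<^sub>L ?k"
        by (simp flip: blinfun_comp.scaleR_left blinfun_compose_assoc)
      then have "(2 * t\<^sup>2) *\<^sub>R (h s o\<^sub>L (?k o\<^sub>L ?k)) = 2 *\<^sub>R ((h s o\<^sub>L ?k) - (?k o\<^sub>L ?k))"
        by (simp only: blinfun_comp.diff_left flip: scaleR_scaleR)
      then show ?thesis
        by (simp add: blinfun_comp.diff_right blinfun_comp.scaleR_right scaleR_2)
    qed
    moreover have "integral {0..N} (\<lambda>t. 2 *\<^sub>R (h (s + t\<^sup>2) o\<^sub>L h (s + t\<^sup>2)) - (h s o\<^sub>L h (s + t\<^sup>2)))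
        = 2 *\<^sub>R D N s - (h s o\<^sub>L G N s)"
    proof -
      have "(\<lambda>t. h s o\<^sub>L h (s + t\<^sup>2)) integrable_on {0..N}"
        by (intro integrable_continuous_interval continuous_intros c1 s)
      then show ?thesis
        using integral_linear[OF i1[OF s] blinfun_comp.bounded_linear_right[of "h s"], of 0 N] i2[OF s]
        by (subst Henstock_Kurzweil_Integration.integral_diff) (auto simp: o_def D_def G_def intro: integrable_cmul)
    qed
    ultimately have "2 *\<^sub>R D N s - (h s o\<^sub>L G N s) = h s o\<^sub>L E N s"
      by (simp add: has_integral_iff)
    then show ?thesis by (simp add: bil algebra_simps)
  qed
  have Gbd: "norm (G N s) \<le> C * (pi / 2)" if "0 \<le> s" "0 \<le> N" for N s
  proof -
    have "norm (h (s + t\<^sup>2)) \<le> C / (1 + t\<^sup>2)" for t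
      by (rule order_trans[OF bd]) (use that C in \<open>auto intro!: divide_left_mono add_pos_nonneg mult_pos_pos\<close>)
    from norm_integral_le_arctan[OF i1[OF that(1)] this _ that(2)] show ?thesis by (simp add: G_def)
  qed
  have Gbd': "norm (G N s) \<le> C * (pi / 2) / sqrt s" if "0 < s" "0 \<le> N" for N s
  proof -
    have "norm (h (s + t\<^sup>2)) \<le> C / (s + t\<^sup>2)" for t
      by (rule order_trans[OF bd]) (use that C in \<open>auto intro!: divide_left_mono add_pos_nonneg mult_pos_pos\<close>)
    from norm_integral_le_arctan[OF i1 this that] that show ?thesis by (simp add: G_def)
  qed
  have Ebd: "norm (E N s) \<le> C / N" if "0 \<le> s" "0 < N" for N s
  proof -
    have "norm (E N s) \<le> N * (C / (1 + (s + N\<^sup>2)))"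
      unfolding E_def norm_scaleR using mult_left_mono[OF bd[of "s + N\<^sup>2"], of N] that by simp
    also have "\<dots> \<le> N * (C / N\<^sup>2)"
      using that C by (intro mult_left_mono divide_left_mono mult_pos_pos) (auto intro: add_pos_nonneg)
    finally show ?thesis using that by (simp add: power2_eq_square)
  qed
  \<comment> \<open>This is \<open>(A + s) h(0) G\<^sup>2\<close>, because \<open>(A + s) h(0) = 1 + s h(0)\<close>.\<close>
  define W where "W N s = (G N s o\<^sub>L G N s) + s *\<^sub>R (h 0 o\<^sub>L (G N s o\<^sub>L G N s))" for N s
  have Wder: "(W N has_vector_derivative - (h 0 o\<^sub>L (G N s o\<^sub>L E N s))) (at s within {0..})"
    if s: "0 \<le> s" and N: "0 \<le> N" for N s
  proof -
    let ?Y' = "(G N s o\<^sub>L - D N s) + (- D N s o\<^sub>L G N s)"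
    let ?Y = "G N s o\<^sub>L G N s" and ?Z = "(G N s o\<^sub>L G N s) + (G N s o\<^sub>L E N s)"
    have GE: "E N s o\<^sub>L G N s = G N s o\<^sub>L E N s"
      unfolding E_def using Gcomm[of s "s + N\<^sup>2" N] s by (simp add: bil)
    have "2 *\<^sub>R ?Y' = - ((G N s o\<^sub>L 2 *\<^sub>R D N s) + (2 *\<^sub>R D N s o\<^sub>L G N s))"
      by (simp add: bil scaleR_add_right scaleR_diff_right)
    also have "\<dots> = - ((G N s o\<^sub>L (h s o\<^sub>L (G N s + E N s))) + (h s o\<^sub>L (G N s + E N s) o\<^sub>L G N s))"
      by (simp only: D_eq[OF s N])
    also have "G N s o\<^sub>L (h s o\<^sub>L (G N s + E N s)) = h s o\<^sub>L ?Z"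
      using Gcomm[OF s s, of N] by (simp add: blinfun_comp.add_right flip: blinfun_compose_assoc)
    also have "h s o\<^sub>L (G N s + E N s) o\<^sub>L G N s = h s o\<^sub>L ?Z"
      using GE by (simp add: bil)
    finally have "2 *\<^sub>R ?Y' = 2 *\<^sub>R - (h s o\<^sub>L ?Z)" by (simp add: scaleR_2)
    then have Y': "?Y' = - (h s o\<^sub>L ?Z)" by (simp only: scaleR_cancel_left) simp
    have dY: "((\<lambda>s. G N s o\<^sub>L G N s) has_vector_derivative ?Y') (at s within {0..})"
      by (rule blinfun_comp.has_vector_derivative[OF Gder[OF s] Gder[OF s]])
    have dhY: "((\<lambda>s. h 0 o\<^sub>L (G N s o\<^sub>L G N s)) has_vector_derivative h 0 o\<^sub>L ?Y') (at s within {0..})"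
      by (rule bounded_linear.has_vector_derivative[OF blinfun_comp.bounded_linear_right dY])
    have "((\<lambda>s. (G N s o\<^sub>L G N s) + s *\<^sub>R (h 0 o\<^sub>L (G N s o\<^sub>L G N s))) has_vector_derivative
        ?Y' + (s *\<^sub>R (h 0 o\<^sub>L ?Y') + 1 *\<^sub>R (h 0 o\<^sub>L ?Y))) (at s within {0..})"
      by (intro has_vector_derivative_add dY has_vector_derivative_scaleR dhY) (auto intro: derivative_intros)
    moreover have "?Y' + (s *\<^sub>R (h 0 o\<^sub>L ?Y') + 1 *\<^sub>R (h 0 o\<^sub>L ?Y)) = - (h 0 o\<^sub>L (G N s o\<^sub>L E N s))"
    proof -
      \<comment> \<open>This is \<open>(1 + s h(0)) h(s) = h(0)\<close>.\<close>
      have "s *\<^sub>R (h 0 o\<^sub>L h s) = h 0 - h s" using resid[of 0 s] s by simp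
      then have "s *\<^sub>R (h 0 o\<^sub>L (h s o\<^sub>L ?Z)) = (h 0 - h s) o\<^sub>L ?Z"
        by (simp flip: blinfun_comp.scaleR_left blinfun_compose_assoc)
      then show ?thesis unfolding Y' by (simp add: bil algebra_simps)
    qed
    ultimately show ?thesis by (simp add: W_def[abs_def])
  qed
  have Wdiff: "norm (W N s - W N 0) \<le> C * (C * (pi / 2) * (C / N)) * s" if s: "0 \<le> s" and N: "0 < N" for N s
  proof -
    have "norm (W N s - W N 0) \<le> C * (C * (pi / 2) * (C / N)) * norm (s - 0)"
    proof (rule differentiable_bound[where S = "{0..}" and f' = "\<lambda>s d. d *\<^sub>R - (h 0 o\<^sub>L (G N s o\<^sub>L E N s))"])
      fix x :: real assume x: "x \<in> {0..}"
      show "(W N has_derivative (\<lambda>d. d *\<^sub>R - (h 0 o\<^sub>L (G N x o\<^sub>L E N x)))) (at x within {0..})"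
        using Wder[of x N] x N by (simp add: has_vector_derivative_def)
      have "norm (h 0 o\<^sub>L (G N x o\<^sub>L E N x)) \<le> C * (C * (pi / 2) * (C / N))"
        by (intro order_trans[OF norm_blinfun_compose] mult_mono bd1 Gbd Ebd) (use x N C in auto)
      then show "onorm (\<lambda>d. d *\<^sub>R - (h 0 o\<^sub>L (G N x o\<^sub>L E N x))) \<le> C * (C * (pi / 2) * (C / N))"
        by (intro onorm_le) (simp only: norm_scaleR norm_minus_cancel mult.commute real_norm_def
            mult_left_mono abs_ge_zero)
    qed (use s in auto)
    with s show ?thesis by simp
  qed
  have Glim: "\<exists>L. ((\<lambda>N. G N s) \<longlongrightarrow> L) at_top" if "0 \<le> s" for s
    unfolding G_def
  proof (rule improper_integral_power_decay[of _ 1 C 2])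
    fix t :: real assume "1 \<le> t"
    have "norm (h (s + t\<^sup>2)) \<le> C / t\<^sup>2"
      by (rule order_trans[OF bd]) (use that C \<open>1 \<le> t\<close> in \<open>auto intro!: divide_left_mono add_pos_nonneg mult_pos_pos\<close>)
    then show "norm (h (s + t\<^sup>2)) \<le> C * t powr - 2"
      using \<open>1 \<le> t\<close> by (simp add: powr_minus divide_inverse)
  qed (use i1 that in auto)
  have main: "norm ((J o\<^sub>L J) - (pi\<^sup>2 / 4) *\<^sub>R h 0) \<le> ((C * (pi / 2)) * (C * (pi / 2)) + (C * (pi / 2)) * (C * (pi / 2)) + (pi / 2) * (C * (pi / 2))) / s"
    if s: "0 < s" for s
  proof -
    obtain L where L: "((\<lambda>N. G N s) \<longlongrightarrow> L) at_top" using Glim[of s] s by auto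
    have J': "((\<lambda>N. G N 0) \<longlongrightarrow> J) at_top" using J by (simp add: G_def)
    have JL: "J o\<^sub>L J = (L o\<^sub>L L) + s *\<^sub>R (h 0 o\<^sub>L (L o\<^sub>L L))"
    proof -
      have Ws: "((\<lambda>N. W N s) \<longlongrightarrow> (L o\<^sub>L L) + s *\<^sub>R (h 0 o\<^sub>L (L o\<^sub>L L))) at_top"
        unfolding W_def by (intro tendsto_add tendsto_scaleR tendsto_const blinfun_comp.tendsto L)
      have W0: "((\<lambda>N. W N 0) \<longlongrightarrow> J o\<^sub>L J) at_top"
        using blinfun_comp.tendsto[OF J' J'] by (simp add: W_def)
      have "((\<lambda>N. W N s - W N 0) \<longlongrightarrow> 0) at_top"
      proof (rule Lim_null_comparison)
        show "\<forall>\<^sub>F N in at_top. norm (W N s - W N 0) \<le> (C * (C * (pi / 2) * C) * s) / N"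
          using eventually_gt_at_top[of 0]
        proof eventually_elim
          case (elim N)
          show ?case using Wdiff[OF less_imp_le[OF s] elim] by (simp add: mult.assoc)
        qed
        show "((\<lambda>N. (C * (C * (pi / 2) * C) * s) / N) \<longlongrightarrow> 0) at_top"
          by (intro tendsto_divide_0[OF tendsto_const] filterlim_at_top_imp_at_infinity filterlim_ident)
      qed
      from tendsto_unique[OF trivial_limit_at_top_linorder tendsto_diff[OF Ws W0] this]
      show ?thesis by simp
    qed
    have Lbd: "norm L \<le> C * (pi / 2) / sqrt s"
      by (rule tendsto_upperbound[OF tendsto_norm[OF L]])
        (use Gbd' s in \<open>auto intro!: eventually_at_top_linorderI[of 0]\<close>)
    have hL: "norm ((h 0 o\<^sub>L L) - (pi / 2 / sqrt s) *\<^sub>R h 0) \<le> (C / s) * (pi / 2) / sqrt s"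
    proof (rule tendsto_upperbound)
      show "((\<lambda>N. norm ((h 0 o\<^sub>L G N s) - (arctan (N / sqrt s) / sqrt s) *\<^sub>R h 0)) \<longlongrightarrow>
          norm ((h 0 o\<^sub>L L) - (pi / 2 / sqrt s) *\<^sub>R h 0)) at_top"
      proof (intro tendsto_norm tendsto_diff blinfun_comp.tendsto tendsto_scaleR tendsto_divide
          tendsto_const L)
        have "LIM N at_top. N * inverse (sqrt s) :> at_top"
          using s by (intro filterlim_at_top_mult_tendsto_pos[OF tendsto_const _ filterlim_ident]) auto
        then have "LIM N at_top. N / sqrt s :> at_top" by (simp add: divide_inverse)
        then show "((\<lambda>N. arctan (N / sqrt s)) \<longlongrightarrow> pi / 2) at_top"
          by (rule filterlim_compose[OF tendsto_arctan_at_top])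
      qed (use s in auto)
      show "\<forall>\<^sub>F N in at_top. norm ((h 0 o\<^sub>L G N s) - (arctan (N / sqrt s) / sqrt s) *\<^sub>R h 0) \<le> (C / s) * (pi / 2) / sqrt s"
      proof (rule eventually_at_top_linorderI[of 0])
        fix N :: real assume N: "0 \<le> N"
        have eq: "h 0 o\<^sub>L h (s + t\<^sup>2) = (1 / (s + t\<^sup>2)) *\<^sub>R h 0 - (1 / (s + t\<^sup>2)) *\<^sub>R h (s + t\<^sup>2)" for t
        proof -
          have "s + t\<^sup>2 > 0" using s by (simp add: add_pos_nonneg)
          then show ?thesis
            using resid[of 0 "s + t\<^sup>2"] by (simp flip: scaleR_diff_right)
        qed
        have cc: "continuous_on X (\<lambda>t. 1 / (s + t\<^sup>2))" for X :: "real set"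
          using s by (intro continuous_intros) (auto simp: add_nonneg_eq_0_iff)
        have i3: "(\<lambda>t. (1 / (s + t\<^sup>2)) *\<^sub>R h (s + t\<^sup>2)) integrable_on {0..N}"
          using s by (intro integrable_continuous_interval continuous_intros cc c1) auto
        have i4: "((\<lambda>t. (1 / (s + t\<^sup>2)) *\<^sub>R h 0) has_integral (arctan (N / sqrt s) / sqrt s) *\<^sub>R h 0) {0..N}"
          by (intro has_integral_scaleR_left integral_inverse_sum_squares s N)
        have "h 0 o\<^sub>L G N s = integral {0..N} (\<lambda>t. h 0 o\<^sub>L h (s + t\<^sup>2))"
          unfolding G_def
          using integral_linear[OF i1 blinfun_comp.bounded_linear_right[of "h 0"]] s
          by (simp add: o_def)
        also have "\<dots> = (arctan (N / sqrt s) / sqrt s) *\<^sub>R h 0 - integral {0..N} (\<lambda>t. (1 / (s + t\<^sup>2)) *\<^sub>R h (s + t\<^sup>2))"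
          unfolding eq using i3 i4 by (simp add: Henstock_Kurzweil_Integration.integral_diff has_integral_iff)
        finally have "norm ((h 0 o\<^sub>L G N s) - (arctan (N / sqrt s) / sqrt s) *\<^sub>R h 0)
            = norm (integral {0..N} (\<lambda>t. (1 / (s + t\<^sup>2)) *\<^sub>R h (s + t\<^sup>2)))" by simp
        also have "\<dots> \<le> (C / s) * (pi / 2) / sqrt s"
        proof (rule norm_integral_le_arctan[OF i3 _ s N])
          fix t :: real
          have p: "0 < s + t\<^sup>2" "s \<le> s + t\<^sup>2" using s by (simp_all add: add_pos_nonneg)
          have "0 \<le> s + t\<^sup>2" "0 < 1 + (s + t\<^sup>2)" "s \<le> 1 + (s + t\<^sup>2)" using p by linarith+
          then have "norm (h (s + t\<^sup>2)) \<le> C / s"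
            using s C by (intro order_trans[OF bd] divide_left_mono mult_pos_pos)
          then show "norm ((1 / (s + t\<^sup>2)) *\<^sub>R h (s + t\<^sup>2)) \<le> C / s / (s + t\<^sup>2)"
            using p divide_right_mono[of "norm (h (s + t\<^sup>2))" "C / s" "s + t\<^sup>2"] by simp
        qed
        finally show "norm ((h 0 o\<^sub>L G N s) - (arctan (N / sqrt s) / sqrt s) *\<^sub>R h 0) \<le> (C / s) * (pi / 2) / sqrt s" .
      qed
    qed simp
    \<comment> \<open>Both \<open>B\<close> and \<open>F\<close> absorb the decay: \<open>B\<close> stays bounded in \<open>s\<close> and \<open>F = O(1 / s)\<close>, whence
      \<open>h(0) B\<^sup>2\<close> differs from \<open>(\<pi> / 2)\<^sup>2 h(0)\<close> by \<open>F B + (\<pi> / 2) F\<close>.\<close>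
    define B where "B = sqrt s *\<^sub>R L"
    define F where "F = (h 0 o\<^sub>L B) - (pi / 2) *\<^sub>R h 0"
    have Bbd: "norm B \<le> C * (pi / 2)"
      using Lbd s by (simp add: B_def field_simps)
    have "F = sqrt s *\<^sub>R ((h 0 o\<^sub>L L) - (pi / 2 / sqrt s) *\<^sub>R h 0)"
      using s by (simp add: F_def B_def blinfun_comp.scaleR_right scaleR_diff_right)
    then have "norm F \<le> sqrt s * ((C / s) * (pi / 2) / sqrt s)"
      using hL s by (simp only: norm_scaleR) (intro mult_mono, simp_all)
    also have "\<dots> = C * (pi / 2) / s" using s by simp
    finally have Fbd: "norm F \<le> C * (pi / 2) / s" .
    have BB: "B o\<^sub>L B = s *\<^sub>R (L o\<^sub>L L)"
      using s by (simp add: B_def blinfun_comp.scaleR_left blinfun_comp.scaleR_right)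
    have "L o\<^sub>L L = (1 / s) *\<^sub>R (B o\<^sub>L B)" using s by (simp add: BB)
    moreover have "s *\<^sub>R (h 0 o\<^sub>L (L o\<^sub>L L)) = h 0 o\<^sub>L (B o\<^sub>L B)"
      by (simp add: BB blinfun_comp.scaleR_right)
    ultimately have J2: "J o\<^sub>L J = (1 / s) *\<^sub>R (B o\<^sub>L B) + (h 0 o\<^sub>L (B o\<^sub>L B))"
      using JL by simp
    have FB: "F o\<^sub>L B = (h 0 o\<^sub>L (B o\<^sub>L B)) - (pi / 2) *\<^sub>R (h 0 o\<^sub>L B)"
      by (simp add: F_def blinfun_comp.diff_left blinfun_comp.scaleR_left blinfun_compose_assoc)
    have "(pi / 2) *\<^sub>R F = (pi / 2) *\<^sub>R (h 0 o\<^sub>L B) - (pi\<^sup>2 / 4) *\<^sub>R h 0"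
      by (simp add: F_def scaleR_diff_right power2_eq_square)
    then have "(J o\<^sub>L J) - (pi\<^sup>2 / 4) *\<^sub>R h 0 = (1 / s) *\<^sub>R (B o\<^sub>L B) + (F o\<^sub>L B) + (pi / 2) *\<^sub>R F"
      by (simp add: FB J2)
    also have "norm \<dots> \<le> (1 / s) * (C * (pi / 2) * (C * (pi / 2))) + (C * (pi / 2) / s) * (C * (pi / 2)) + (pi / 2) * (C * (pi / 2) / s)"
    proof (intro norm_triangle_le add_mono)
      show "norm ((1 / s) *\<^sub>R (B o\<^sub>L B)) \<le> (1 / s) * (C * (pi / 2) * (C * (pi / 2)))"
        unfolding norm_scaleR using s C
        by (intro mult_mono order_trans[OF norm_blinfun_compose] Bbd) auto
      show "norm (F o\<^sub>L B) \<le> (C * (pi / 2) / s) * (C * (pi / 2))"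
        using s C by (intro mult_mono order_trans[OF norm_blinfun_compose] Bbd Fbd) auto
      show "norm ((pi / 2) *\<^sub>R F) \<le> (pi / 2) * (C * (pi / 2) / s)"
        using mult_left_mono[OF Fbd, of "pi / 2"] by simp
    qed
    finally show ?thesis by (simp add: add_divide_distrib)
  qed
  let ?c = "(C * (pi / 2)) * (C * (pi / 2)) + (C * (pi / 2)) * (C * (pi / 2)) + (pi / 2) * (C * (pi / 2))"
  have "norm ((J o\<^sub>L J) - (pi\<^sup>2 / 4) *\<^sub>R h 0) \<le> 0"
  proof (rule tendsto_lowerbound)
    show "((\<lambda>s. ?c / s) \<longlongrightarrow> 0) at_top"
      by (intro tendsto_divide_0[OF tendsto_const] filterlim_at_top_imp_at_infinity filterlim_ident)
    show "\<forall>\<^sub>F s in at_top. norm ((J o\<^sub>L J) - (pi\<^sup>2 / 4) *\<^sub>R h 0) \<le> ?c / s"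
      using eventually_gt_at_top[of 0] by eventually_elim (rule main)
  qed simp
  then show ?thesis by simp
qed

section \<open>Strong limits of bounded operators\<close>

text \<open>By Baire one of the closed sets on which all operators are bounded by \<open>k\<close> contains a ball, and
  linearity moves the bound on a ball to the unit ball.\<close>

lemma uniform_boundedness:
  fixes F :: "nat \<Rightarrow> 'a::banach \<Rightarrow>\<^sub>L 'b::real_normed_vector"
  assumes ptw: "\<And>x. bounded (range (\<lambda>n. F n x))"
  shows "\<exists>K. \<forall>n x. norm (F n x) \<le> K * norm x"
proof -
  define E where "E k = {x. \<forall>n. norm (F n x) \<le> real k}" for k :: nat
  have cl: "closed (E k)" for k
  proof -
    have "E k = (\<Inter>n. {x. norm (F n x) \<le> real k})" by (auto simp: E_def)
    moreover have "closed {x. norm (F n x) \<le> real k}" for n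
      by (intro closed_Collect_le continuous_intros)
    ultimately show ?thesis by auto
  qed
  have "\<exists>k. interior (E k) \<noteq> {}"
  proof (rule ccontr)
    assume "\<not> (\<exists>k. interior (E k) \<noteq> {})"
    then have "euclidean interior_of \<Union>(range E) = {}"
      using Met_TC.metric_Baire_category_alt[of "range E"] cl complete_UNIV by auto
    moreover have "\<Union>(range E) = UNIV"
    proof -
      have "\<exists>k. x \<in> E k" for x
      proof -
        obtain B where "\<And>n. norm (F n x) \<le> B" using ptw[of x] by (auto simp: bounded_iff)
        moreover obtain k :: nat where "B \<le> real k" using real_arch_simple by blast
        ultimately show ?thesis unfolding E_def by (blast intro: order_trans)
      qed
      then show ?thesis by auto
    qed
    ultimately show False by auto
  qed
  then obtain k x0 where "x0 \<in> interior (E k)" by blast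
  then obtain e where e: "0 < e" "cball x0 e \<subseteq> E k" by (auto simp: mem_interior_cball)
  have "norm (F n x) \<le> (2 * real k / e) * norm x" for n x
  proof (cases "x = 0")
    case False
    define y where "y = (e / norm x) *\<^sub>R x"
    have y: "norm y = e" using False e by (simp add: y_def)
    have "x0 + y \<in> cball x0 e" "x0 \<in> cball x0 e" using e y by (simp_all add: dist_norm)
    then have "x0 + y \<in> E k" "x0 \<in> E k" using e(2) by blast+
    then have "norm (F n (x0 + y)) \<le> real k" "norm (F n x0) \<le> real k" by (auto simp: E_def)
    moreover have "F n y = F n (x0 + y) - F n x0" by (simp add: blinfun.add_right)
    ultimately have "norm (F n y) \<le> 2 * real k"
      using norm_triangle_ineq4[of "F n (x0 + y)" "F n x0"] by simp
    then have "e / norm x * norm (F n x) \<le> 2 * real k"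
      using e by (simp add: y_def blinfun.scaleR_right)
    then show ?thesis using e False by (simp add: field_simps)
  qed (simp add: blinfun.zero_right)
  then show ?thesis by blast
qed

lemma bounded_linear_strong_limit:
  fixes F :: "real \<Rightarrow> 'a::banach \<Rightarrow>\<^sub>L 'b::real_normed_vector"
  assumes lim: "\<And>x. ((\<lambda>N. F N x) \<longlongrightarrow> L x) at_top"
  shows "bounded_linear L"
proof -
  have seq: "(\<lambda>n. F (real n) x) \<longlonglongrightarrow> L x" for x
    using lim filterlim_real_sequentially by (rule filterlim_compose)
  then have "bounded (range (\<lambda>n. F (real n) x))" for x
    using convergent_imp_bounded by blast
  from uniform_boundedness[of "\<lambda>n. F (real n)", OF this]
  obtain K where K: "\<And>n x. norm (F (real n) x) \<le> K * norm x" by blast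
  show ?thesis
  proof (rule bounded_linear_intro[where K = K])
    show "L (x + y) = L x + L y" for x y
      by (rule LIMSEQ_unique[OF seq]) (simp add: blinfun.add_right tendsto_add seq)
    show "L (r *\<^sub>R x) = r *\<^sub>R L x" for r x
      by (rule LIMSEQ_unique[OF seq]) (simp add: blinfun.scaleR_right tendsto_scaleR seq)
    show "norm (L x) \<le> norm x * K" for x
      by (rule tendsto_upperbound[OF tendsto_norm[OF seq]]) (use K in \<open>auto simp: mult.commute\<close>)
  qed
qed

section \<open>The sign of an operator with resolvents on the imaginary axis\<close>

text \<open>The real part of the integrand contributes the total increment of an arctangent, while the
  logarithm coming from the imaginary part cancels between the two ends.\<close>

lemma pv_integral_inverse_shift:
  assumes "Re \<mu> \<noteq> 0"
  shows "((\<lambda>N. integral {-N..N} (\<lambda>t. 1 / (\<i> * complex_of_real t - \<mu>)))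
    \<longlongrightarrow> complex_of_real (- pi * sgn (Re \<mu>))) at_top"
proof -
  define a b where "a = Re \<mu>" and "b = Im \<mu>"
  have a: "a \<noteq> 0" using assms by (simp add: a_def)
  define F where "F t = complex_of_real (- arctan ((t - b) / a))
    + (- \<i> / 2) * complex_of_real (ln (a\<^sup>2 + (t - b)\<^sup>2))" for t
  have pos: "0 < a\<^sup>2 + (t - b)\<^sup>2" for t using a by (simp add: add_pos_nonneg)
  have der: "(F has_vector_derivative 1 / (\<i> * complex_of_real t - \<mu>)) (at t within X)" for t X
  proof -
    have 1: "((\<lambda>t. - arctan ((t - b) / a)) has_real_derivative - (a / (a\<^sup>2 + (t - b)\<^sup>2))) (at t within X)"
    proof -
      have "inverse (1 + ((t - b) / a)\<^sup>2) * (1 / a) = a / (a\<^sup>2 + (t - b)\<^sup>2)"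
      proof -
        have "1 + ((t - b) / a)\<^sup>2 = (a\<^sup>2 + (t - b)\<^sup>2) / a\<^sup>2"
          using a by (simp add: power_divide add_divide_distrib)
        then show ?thesis using a by (simp add: power2_eq_square)
      qed
      then show ?thesis using a by (auto intro!: derivative_eq_intros)
    qed
    have 2: "((\<lambda>t. ln (a\<^sup>2 + (t - b)\<^sup>2)) has_real_derivative 2 * (t - b) / (a\<^sup>2 + (t - b)\<^sup>2)) (at t within X)"
      using pos[of t] by (auto intro!: derivative_eq_intros)
    have "(F has_vector_derivative complex_of_real (- (a / (a\<^sup>2 + (t - b)\<^sup>2)))
        + (- \<i> / 2) * complex_of_real (2 * (t - b) / (a\<^sup>2 + (t - b)\<^sup>2))) (at t within X)"
      unfolding F_def
      by (intro has_vector_derivative_add has_vector_derivative_mult_right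
          has_vector_derivative_of_real)
        (use 1 2 in \<open>simp_all add: has_real_derivative_iff_has_vector_derivative\<close>)
    moreover have "complex_of_real (- (a / (a\<^sup>2 + (t - b)\<^sup>2)))
        + (- \<i> / 2) * complex_of_real (2 * (t - b) / (a\<^sup>2 + (t - b)\<^sup>2)) = 1 / (\<i> * complex_of_real t - \<mu>)"
    proof -
      let ?D = "a\<^sup>2 + (t - b)\<^sup>2" and ?Z = "\<i> * complex_of_real t - \<mu>"
      have "Complex (- a) (- (t - b)) * ?Z = complex_of_real ?D"
        by (rule complex_eqI) (simp_all add: a_def b_def power2_eq_square algebra_simps)
      moreover have D: "complex_of_real ?D \<noteq> 0" using pos[of t] by (simp only: of_real_eq_0_iff)
      ultimately have "Complex (- a) (- (t - b)) / complex_of_real ?D = 1 / ?Z"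
        by (metis divide_divide_eq_right div_by_1 mult_eq_0_iff nonzero_mult_divide_mult_cancel_left
            mult.right_neutral)
      moreover have "Complex (- a) (- (t - b)) / complex_of_real ?D
          = complex_of_real (- (a / ?D)) + (- \<i> / 2) * complex_of_real (2 * (t - b) / ?D)"
      proof -
        have "Complex (- x) (- y) = complex_of_real (- x) + (- \<i> / 2) * complex_of_real (2 * y)" for x y
          by (rule complex_eqI) simp_all
        from this[of "a / ?D" "(t - b) / ?D"]
        have "Complex (- (a / ?D)) (- ((t - b) / ?D))
            = complex_of_real (- (a / ?D)) + (- \<i> / 2) * complex_of_real (2 * (t - b) / ?D)"
          by (simp only: times_divide_eq_right)
        moreover have "Complex (- a) (- (t - b)) / complex_of_real ?D
            = Complex (- (a / ?D)) (- ((t - b) / ?D))"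
          by (rule complex_eqI)
            (simp_all only: Re_divide_of_real Im_divide_of_real complex.sel minus_divide_left)
        ultimately show ?thesis by simp
      qed
      ultimately show ?thesis by simp
    qed
    ultimately show ?thesis by simp
  qed
  have "integral {-N..N} (\<lambda>t. 1 / (\<i> * complex_of_real t - \<mu>)) = F N - F (- N)" if "0 \<le> N" for N
    by (rule integral_unique, rule fundamental_theorem_of_calculus) (use der that in auto)
  then have ev: "\<forall>\<^sub>F N in at_top. F N - F (- N) = integral {-N..N} (\<lambda>t. 1 / (\<i> * complex_of_real t - \<mu>))"
    by (auto intro: eventually_at_top_linorderI[of 0])
  have l1: "((\<lambda>N. - arctan ((N - b) / a) + arctan ((- N - b) / a)) \<longlongrightarrow> - pi * sgn a) at_top"
  proof (cases "a > 0")
    case True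
    then have "((\<lambda>N. - arctan ((N - b) / a) + arctan ((- N - b) / a)) \<longlongrightarrow> - pi) at_top"
      by real_asymp
    with True show ?thesis by simp
  next
    case False
    with a have "a < 0" by simp
    then have "((\<lambda>N. - arctan ((N - b) / a) + arctan ((- N - b) / a)) \<longlongrightarrow> pi) at_top"
      by real_asymp
    with \<open>a < 0\<close> show ?thesis by simp
  qed
  have l2: "((\<lambda>N. ln (a\<^sup>2 + (N - b)\<^sup>2) - ln (a\<^sup>2 + (- N - b)\<^sup>2)) \<longlongrightarrow> 0) at_top"
    by real_asymp
  have "((\<lambda>N. complex_of_real (- arctan ((N - b) / a) + arctan ((- N - b) / a))
      + (- \<i> / 2) * complex_of_real (ln (a\<^sup>2 + (N - b)\<^sup>2) - ln (a\<^sup>2 + (- N - b)\<^sup>2)))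
      \<longlongrightarrow> complex_of_real (- pi * sgn a) + (- \<i> / 2) * complex_of_real 0) at_top"
    by (intro tendsto_intros tendsto_of_real l1 l2)
  then have "((\<lambda>N. F N - F (- N)) \<longlongrightarrow> complex_of_real (- pi * sgn a)) at_top"
    by (simp add: F_def algebra_simps)
  from Lim_transform_eventually[OF this ev] show ?thesis by (simp add: a_def)
qed

lemma one_plus_abs_le_shift:
  assumes "Re \<mu> \<noteq> 0"
  shows "1 + \<bar>t\<bar> \<le> ((1 + \<bar>Im \<mu>\<bar>) / \<bar>Re \<mu>\<bar> + 1) * cmod (\<i> * complex_of_real t - \<mu>)"
proof -
  let ?z = "\<i> * complex_of_real t - \<mu>"
  have "\<bar>Re \<mu>\<bar> \<le> cmod ?z" using abs_Re_le_cmod[of ?z] by simp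
  then have "(1 + \<bar>Im \<mu>\<bar>) / \<bar>Re \<mu>\<bar> * \<bar>Re \<mu>\<bar> \<le> (1 + \<bar>Im \<mu>\<bar>) / \<bar>Re \<mu>\<bar> * cmod ?z"
    by (intro mult_left_mono) auto
  then have "1 + \<bar>Im \<mu>\<bar> \<le> (1 + \<bar>Im \<mu>\<bar>) / \<bar>Re \<mu>\<bar> * cmod ?z" using assms by simp
  moreover have "\<bar>t\<bar> \<le> cmod ?z + \<bar>Im \<mu>\<bar>" using abs_Im_le_cmod[of ?z] by simp
  ultimately show ?thesis by (simp only: distrib_right mult_1)
qed

text \<open>The resolvent estimate on the imaginary axis is normalised with \<open>1 + |t|\<close>, which covers boundedness
  near zero and decay at infinity by one constant.\<close>

locale imaginary_axis_resolvent =
  fixes T :: "'a::complex_banach operator" and K :: real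
  assumes lin: "linear_operator T" and dense: "densely_defined T"
    and res: "\<And>t. \<i> * complex_of_real t \<in> resolvent_set T"
    and below: "\<And>t. bounded_below T (\<i> * complex_of_real t) (K / (1 + \<bar>t\<bar>))"
    and K: "0 \<le> K"
begin

text \<open>Resolvents as elements of the Banach space of bounded real-linear operators, in order to
  differentiate and integrate them in the operator norm.\<close>

definition RB :: "real \<Rightarrow> 'a \<Rightarrow>\<^sub>L 'a" where
  "RB t = Blinfun (resolvent T (\<i> * complex_of_real t))"

lemma RB_apply: "RB t x = resolvent T (\<i> * complex_of_real t) x"
  unfolding RB_def by (rule bounded_linear_Blinfun_apply[OF bounded_linear_resolvent[OF lin res], THEN fun_cong])

lemma norm_RB_le: "norm (RB t) \<le> K / (1 + \<bar>t\<bar>)"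
  by (rule norm_blinfun_bound) (use K norm_resolvent_le[OF res below] in \<open>auto simp: RB_apply\<close>)

lemma norm_RB_apply_le: "norm (RB t x) \<le> K / (1 + \<bar>t\<bar>) * norm x"
  using norm_resolvent_le[OF res below] by (simp add: RB_apply)

lemma RB_in_dom: "RB t x \<in> op_dom T"
  by (simp add: RB_apply resolvent_in_dom res)

lemma op_app_RB: "op_app T (RB t x) = x + (\<i> * complex_of_real t) *\<^sub>C RB t x"
  by (simp add: RB_apply op_app_resolvent res)

lemma RB_shift: "x \<in> op_dom T \<Longrightarrow> RB t (op_app T x - (\<i> * complex_of_real t) *\<^sub>C x) = x"
  by (simp add: RB_apply resolvent_left res)

lemma RB_0_op_app: "x \<in> op_dom T \<Longrightarrow> RB 0 (op_app T x) = x"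
  using RB_shift[of x 0] by simp

lemma RB_commute: "RB s (RB t x) = RB t (RB s x)"
  by (simp add: RB_apply resolvent_commute lin res)

lemma RB_scaleC: "RB t (a *\<^sub>C x) = a *\<^sub>C RB t x"
  by (simp add: RB_apply resolvent_scaleC lin res)

lemma continuous_RB: "continuous_on X RB"
proof (rule lipschitz_on_continuous_on)
  show "(K * K)-lipschitz_on X RB"
  proof (rule lipschitz_onI)
    have RK: "norm (RB t x) \<le> K * norm x" for t x
    proof -
      have "K / (1 + \<bar>t\<bar>) \<le> K / 1" using K by (intro divide_left_mono) auto
      then show ?thesis
        using norm_RB_apply_le[of t x] mult_right_mono[of "K / (1 + \<bar>t\<bar>)" K "norm x"] by simp
    qed
    show "dist (RB s) (RB t) \<le> K * K * dist s t" for s t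
      unfolding dist_norm
    proof (rule norm_blinfun_bound)
      fix x
      have "(RB s - RB t) x = (\<i> * complex_of_real s - \<i> * complex_of_real t) *\<^sub>C RB s (RB t x)"
        by (simp add: RB_apply blinfun.diff_left resolvent_identity lin res)
      also have "norm \<dots> = \<bar>s - t\<bar> * norm (RB s (RB t x))"
        by (simp add: norm_scaleC norm_mult flip: right_diff_distrib of_real_diff)
      also have "\<dots> \<le> \<bar>s - t\<bar> * (K * (K * norm x))"
        using K by (intro mult_left_mono order_trans[OF RK] RK) auto
      finally show "norm ((RB s - RB t) x) \<le> K * K * norm (s - t) * norm x"
        by (simp add: mult_ac)
    qed (use K in auto)
  qed (use K in auto)
qed

lemma continuous_RB_apply: "continuous_on X (\<lambda>t. RB t x)"
  by (intro continuous_intros continuous_RB)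

lemma integrable_RB: "RB integrable_on {a..b}" "(\<lambda>t. RB t x) integrable_on {a..b}"
  by (intro integrable_continuous_interval continuous_RB continuous_RB_apply)+

subsection \<open>The resolvent of the square\<close>

text \<open>This is \<open>(T\<^sup>2 + u)\<^sup>-\<^sup>1\<close>, from the factorisation of \<open>T\<^sup>2 + u\<close> into \<open>T - i \<surd>u\<close> and \<open>T + i \<surd>u\<close>.\<close>

definition square_resolvent :: "real \<Rightarrow> 'a \<Rightarrow>\<^sub>L 'a" where
  "square_resolvent u = RB (sqrt u) o\<^sub>L RB (- sqrt u)"

lemma op_app_RB_RB:
  "op_app T (RB t (RB (- t) y)) = RB t y - (\<i> * complex_of_real t) *\<^sub>C RB t (RB (- t) y)"
  using op_app_RB[of "- t" "RB t y"] by (simp add: RB_commute[of t])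

lemma op_app_twice_RB_RB:
  "op_app T (RB t (RB (- t) y)) \<in> op_dom T"
  "op_app T (op_app T (RB t (RB (- t) y))) = y - t\<^sup>2 *\<^sub>R RB t (RB (- t) y)"
proof -
  let ?w = "RB t (RB (- t) y)" and ?c = "\<i> * complex_of_real t"
  show "op_app T ?w \<in> op_dom T"
    unfolding op_app_RB_RB by (intro linear_operatorD[OF lin] RB_in_dom)
  have "op_app T (op_app T ?w) = op_app T (RB t y) - ?c *\<^sub>C op_app T ?w"
    using op_app_RB_RB[of t y] linear_operatorD(8)[OF lin RB_in_dom, of "?c *\<^sub>C ?w" t y]
    by (simp add: linear_operatorD[OF lin] RB_in_dom)
  also have "\<dots> = (y + ?c *\<^sub>C RB t y) - ?c *\<^sub>C (RB t y - ?c *\<^sub>C ?w)"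
    by (simp only: op_app_RB[of t y] op_app_RB_RB[of t y])
  also have "\<dots> = y + (?c * ?c) *\<^sub>C ?w"
    by (simp add: scaleC.scale_right_diff_distrib)
  also have "?c * ?c = - complex_of_real (t\<^sup>2)"
    by (rule complex_eqI) (simp_all add: power2_eq_square)
  also have "- complex_of_real (t\<^sup>2) *\<^sub>C ?w = - (t\<^sup>2 *\<^sub>R ?w)"
    by (simp add: scaleR_scaleC)
  finally show "op_app T (op_app T ?w) = y - t\<^sup>2 *\<^sub>R ?w" by simp
qed

lemma RB_RB_square_shift:
  assumes w: "w \<in> op_dom T" "op_app T w \<in> op_dom T"
  shows "RB s (RB (- s) (op_app T (op_app T w) + s\<^sup>2 *\<^sub>R w)) = w"
proof -
  let ?c = "\<i> * complex_of_real s"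
  define v where "v = op_app T w - ?c *\<^sub>C w"
  have v: "v \<in> op_dom T" unfolding v_def by (intro linear_operatorD[OF lin] w)
  have "op_app T v - (\<i> * complex_of_real (- s)) *\<^sub>C v
      = op_app T (op_app T w) - (?c * ?c) *\<^sub>C w"
    unfolding v_def
    by (simp add: linear_operatorD[OF lin] w scaleC.scale_right_diff_distrib)
  also have "\<dots> = op_app T (op_app T w) + s\<^sup>2 *\<^sub>R w"
  proof -
    have "?c * ?c = - complex_of_real (s\<^sup>2)" by (rule complex_eqI) (simp_all add: power2_eq_square)
    then show ?thesis by (simp add: scaleR_scaleC)
  qed
  finally have "RB (- s) (op_app T (op_app T w) + s\<^sup>2 *\<^sub>R w) = v"
    using RB_shift[OF v, of "- s"] by simp
  moreover have "RB s v = w" unfolding v_def by (rule RB_shift[OF w(1)])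
  ultimately show ?thesis by simp
qed

lemma square_resolvent_identity:
  assumes "0 \<le> u" "0 \<le> v"
  shows "square_resolvent u - square_resolvent v
    = (v - u) *\<^sub>R (square_resolvent u o\<^sub>L square_resolvent v)"
proof (rule blinfun_eqI)
  fix y
  let ?w = "square_resolvent v y"
  have w: "?w \<in> op_dom T" "op_app T ?w \<in> op_dom T" "op_app T (op_app T ?w) = y - v *\<^sub>R ?w"
    using op_app_twice_RB_RB[of "sqrt v" y] assms
    by (simp_all add: square_resolvent_def RB_in_dom)
  have "y = (op_app T (op_app T ?w) + u *\<^sub>R ?w) + (v - u) *\<^sub>R ?w"
    by (simp add: w(3) scaleR_left_diff_distrib)
  then have "square_resolvent u y = square_resolvent u (op_app T (op_app T ?w) + u *\<^sub>R ?w)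
      + (v - u) *\<^sub>R square_resolvent u ?w"
    by (metis blinfun.add_right blinfun.scaleR_right)
  moreover have "square_resolvent u (op_app T (op_app T ?w) + u *\<^sub>R ?w) = ?w"
    using RB_RB_square_shift[OF w(1,2), of "sqrt u"] assms by (simp add: square_resolvent_def)
  ultimately show "(square_resolvent u - square_resolvent v) y
      = ((v - u) *\<^sub>R (square_resolvent u o\<^sub>L square_resolvent v)) y"
    by (simp add: blinfun.diff_left blinfun.scaleR_left)
qed

lemma norm_square_resolvent_le:
  assumes "0 \<le> u"
  shows "norm (square_resolvent u) \<le> (K * K) / (1 + u)"
proof -
  have "norm (square_resolvent u) \<le> (K / (1 + \<bar>sqrt u\<bar>)) * (K / (1 + \<bar>- sqrt u\<bar>))"
    unfolding square_resolvent_def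
    by (intro order_trans[OF norm_blinfun_compose] mult_mono norm_RB_le) (use K in auto)
  also have "\<dots> = (K * K) / ((1 + sqrt u) * (1 + sqrt u))" using assms by simp
  also have "\<dots> \<le> (K * K) / (1 + u)"
    using assms K by (intro divide_left_mono) (auto simp: algebra_simps intro: add_pos_nonneg)
  finally show ?thesis .
qed

lemma square_resolvent_square: "square_resolvent (t\<^sup>2) y = RB t (RB (- t) y)"
  by (cases "0 \<le> t") (auto simp: square_resolvent_def RB_commute[of "- t"])

lemma integrable_square_resolvent: "(\<lambda>t. square_resolvent (t\<^sup>2)) integrable_on {a..b}"
proof -
  have "square_resolvent (t\<^sup>2) = RB t o\<^sub>L RB (- t)" for t
    by (rule blinfun_eqI) (simp add: square_resolvent_square)
  then show ?thesis
    by (simp only:) (intro integrable_continuous_interval continuous_intros continuous_RB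
        continuous_on_compose2[OF continuous_RB[of UNIV]], auto)
qed

lemma inverse_square_sqrt:
  obtains J where "((\<lambda>N. integral {0..N} (\<lambda>t. square_resolvent (t\<^sup>2))) \<longlongrightarrow> J) at_top"
    and "J o\<^sub>L J = (pi\<^sup>2 / 4) *\<^sub>R square_resolvent 0"
proof -
  have "\<exists>J. ((\<lambda>N. integral {0..N} (\<lambda>t. square_resolvent (t\<^sup>2))) \<longlongrightarrow> J) at_top"
  proof (rule improper_integral_power_decay[of _ 1 "K * K" 2])
    show "(\<lambda>t. square_resolvent (t\<^sup>2)) integrable_on {a..b}" for a b
      by (rule integrable_square_resolvent)
    fix t :: real assume t: "1 \<le> t"
    have "norm (square_resolvent (t\<^sup>2)) \<le> (K * K) / (1 + t\<^sup>2)"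
      by (rule norm_square_resolvent_le) simp
    also have "\<dots> \<le> (K * K) / t\<^sup>2"
      using t K by (intro divide_left_mono mult_pos_pos) (auto intro: add_pos_nonneg)
    finally show "norm (square_resolvent (t\<^sup>2)) \<le> K * K * t powr - 2"
      using t by (simp add: powr_minus divide_inverse)
  qed auto
  then obtain J where J: "((\<lambda>N. integral {0..N} (\<lambda>t. square_resolvent (t\<^sup>2))) \<longlongrightarrow> J) at_top" by blast
  from that[OF J inverse_sqrt_square[OF square_resolvent_identity norm_square_resolvent_le J]]
  show thesis .
qed

end

subsection \<open>The sign operator\<close>

text \<open>The vector \<open>q\<close> stands for the image of \<open>x\<close> under an involution; the two summands are then the
  components of \<open>x\<close> in the eigenspaces for \<open>1\<close> and \<open>-1\<close>, written with explicit factors \<open>\<sigma> = \<plusminus>1\<close>.\<close>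

lemma half_plus_half_minus:
  fixes x q :: "'b::real_vector"
  shows "(1 / 2) *\<^sub>R (x + 1 *\<^sub>R q) + (1 / 2) *\<^sub>R (x + (- 1) *\<^sub>R q) = x"
    and "(1 / 2) *\<^sub>R (x + 1 *\<^sub>R q) - (1 / 2) *\<^sub>R (x + (- 1) *\<^sub>R q) = q"
proof -
  have "(x + 1 *\<^sub>R q) + (x + (- 1) *\<^sub>R q) = x + x" "(x + 1 *\<^sub>R q) - (x + (- 1) *\<^sub>R q) = q + q"
    by simp_all
  then show "(1 / 2) *\<^sub>R (x + 1 *\<^sub>R q) + (1 / 2) *\<^sub>R (x + (- 1) *\<^sub>R q) = x"
    and "(1 / 2) *\<^sub>R (x + 1 *\<^sub>R q) - (1 / 2) *\<^sub>R (x + (- 1) *\<^sub>R q) = q"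
    by (simp_all only: scaleR_half_double flip: scaleR_add_right scaleR_diff_right)
qed

lemma proj_along_unique:
  assumes "csubspace U" "csubspace W" "U \<inter> W = {0}" "u \<in> U" "x - u \<in> W"
  shows "proj_along U W x = u"
  unfolding proj_along_def
proof (rule the_equality)
  fix v assume v: "v \<in> U \<and> x - v \<in> W"
  have "v - u \<in> U" using v assms(1,4) by (simp add: scaleC.subspace_diff)
  moreover have "v - u \<in> W"
    using scaleC.subspace_diff[OF assms(2,5), of "x - v"] v by simp
  ultimately have "v - u \<in> {0}" unfolding assms(3)[symmetric] by (rule IntI)
  then show "v = u" by simp
qed (use assms in auto)

text \<open>Under the estimate of the previous locale the resolvent decays only like \<open>1 / |t|\<close>, so that strong
  convergence of the truncated integrals is a genuine further hypothesis.\<close>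

locale pv_resolvent = imaginary_axis_resolvent +
  assumes pv: "\<And>x. \<exists>L. ((\<lambda>N. integral {-N..N} (\<lambda>t. RB t x)) \<longlongrightarrow> L) at_top"
begin

definition sign_op :: "'a \<Rightarrow> 'a" where
  "sign_op x = (1 / pi) *\<^sub>R Lim at_top (\<lambda>N. integral {-N..N} (\<lambda>t. RB t x))"

lemma tendsto_sign_op:
  "((\<lambda>N. integral {-N..N} (\<lambda>t. RB t x)) \<longlongrightarrow> pi *\<^sub>R sign_op x) at_top"
proof -
  obtain L where L: "((\<lambda>N. integral {-N..N} (\<lambda>t. RB t x)) \<longlongrightarrow> L) at_top" using pv by blast
  then have "Lim at_top (\<lambda>N. integral {-N..N} (\<lambda>t. RB t x)) = L"
    by (intro tendsto_Lim) auto
  with L show ?thesis by (simp add: sign_op_def)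
qed

lemma sign_op_eqI:
  assumes "((\<lambda>N. integral {-N..N} (\<lambda>t. RB t x)) \<longlongrightarrow> pi *\<^sub>R y) at_top"
  shows "sign_op x = y"
  using tendsto_unique[OF trivial_limit_at_top_linorder tendsto_sign_op assms] by simp

lemma bounded_linear_sign_op: "bounded_linear sign_op"
proof -
  have "bounded_linear (\<lambda>x. pi *\<^sub>R sign_op x)"
  proof (rule bounded_linear_strong_limit[where F = "\<lambda>N. integral {-N..N} RB"])
    show "((\<lambda>N. (integral {-N..N} RB) x) \<longlongrightarrow> pi *\<^sub>R sign_op x) at_top" for x
      using tendsto_sign_op[of x] by (simp add: blinfun_apply_integral integrable_RB)
  qed
  from bounded_linear_compose[OF bounded_linear_scaleR_right[of "1 / pi"] this]
  show ?thesis by simp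
qed

lemma sign_op_commute:
  assumes B: "bounded_linear B" and comm: "\<And>t x. RB t (B x) = B (RB t x)"
  shows "sign_op (B x) = B (sign_op x)"
proof (rule sign_op_eqI)
  have "integral {-N..N} (\<lambda>t. RB t (B x)) = B (integral {-N..N} (\<lambda>t. RB t x))" for N
    using integral_linear[OF integrable_RB(2) B, of "-N" N x] by (simp add: o_def comm)
  moreover have "((\<lambda>N. B (integral {-N..N} (\<lambda>t. RB t x))) \<longlongrightarrow> B (pi *\<^sub>R sign_op x)) at_top"
    by (rule bounded_linear.tendsto[OF B tendsto_sign_op])
  ultimately show "((\<lambda>N. integral {-N..N} (\<lambda>t. RB t (B x))) \<longlongrightarrow> pi *\<^sub>R B (sign_op x)) at_top"
    by (simp add: linear_scale[OF bounded_linear.linear[OF B]])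
qed

lemma sign_op_scaleC: "sign_op (a *\<^sub>C x) = a *\<^sub>C sign_op x"
  by (rule sign_op_commute[OF bounded_linear_scaleC]) (rule RB_scaleC)

lemma sign_op_RB: "sign_op (RB s x) = RB s (sign_op x)"
  by (rule sign_op_commute) (auto intro: blinfun.bounded_linear_right RB_commute)

text \<open>Commuting with \<open>T\<^sup>-\<^sup>1\<close> means leaving its range, the domain of \<open>T\<close>, invariant and commuting with \<open>T\<close>
  there.\<close>

lemma sign_op_in_dom:
  assumes x: "x \<in> op_dom T"
  shows "sign_op x \<in> op_dom T" and "op_app T (sign_op x) = sign_op (op_app T x)"
proof -
  have "sign_op x = RB 0 (sign_op (op_app T x))"
    using sign_op_RB[of 0 "op_app T x"] by (simp add: RB_0_op_app x)
  then show "sign_op x \<in> op_dom T" "op_app T (sign_op x) = sign_op (op_app T x)"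
    using RB_in_dom[of 0] op_app_RB[of 0] by simp_all
qed

text \<open>With \<open>w = h(t\<^sup>2) y\<close>, factoring \<open>T\<^sup>2 + t\<^sup>2\<close> in the two possible orders gives two formulas for \<open>T w\<close>
  whose sum is \<open>2 T w = R\<^sub>t y + R\<^sub>-\<^sub>t y\<close>.\<close>

lemma RB_plus_RB: "RB 0 (RB t y + RB (- t) y) = 2 *\<^sub>R RB t (RB (- t) y)"
proof -
  let ?w = "RB t (RB (- t) y)"
  have "op_app T ?w = RB (- t) y + (\<i> * complex_of_real t) *\<^sub>C ?w"
    using op_app_RB_RB[of "- t" y] by (simp add: RB_commute[of "- t"])
  from arg_cong2[OF op_app_RB_RB[of t y] this, of "(+)"]
  have "op_app T ?w + op_app T ?w = RB t y + RB (- t) y" by simp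
  then have "RB 0 (RB t y + RB (- t) y) = RB 0 (op_app T ?w) + RB 0 (op_app T ?w)"
    by (metis blinfun.add_right)
  then show ?thesis by (simp add: RB_0_op_app RB_in_dom scaleR_2)
qed

text \<open>On the range of \<open>T\<^sup>-\<^sup>1\<close> the sign is \<open>(2 / \<pi>) J T\<close> with the inverse square root \<open>J\<close> of \<open>T\<^sup>2\<close>, so its
  square is the identity on the range of \<open>T\<^sup>-\<^sup>2\<close>, which is dense because that of \<open>T\<^sup>-\<^sup>1\<close> is.\<close>

lemma sign_op_sign_op: "sign_op (sign_op x) = x"
proof -
  obtain J where J: "((\<lambda>N. integral {0..N} (\<lambda>t. square_resolvent (t\<^sup>2))) \<longlongrightarrow> J) at_top"
    and JJ: "J o\<^sub>L J = (pi\<^sup>2 / 4) *\<^sub>R square_resolvent 0"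
    by (rule inverse_square_sqrt)
  have QJ: "sign_op (RB 0 y) = (2 / pi) *\<^sub>R J y" for y
  proof (rule sign_op_eqI)
    have "integral {-N..N} (\<lambda>t. RB t (RB 0 y)) = 2 *\<^sub>R (integral {0..N} (\<lambda>t. square_resolvent (t\<^sup>2))) y"
      if "0 \<le> N" for N
    proof -
      have "integral {-N..N} (\<lambda>t. RB t (RB 0 y)) = integral {0..N} (\<lambda>t. RB t (RB 0 y) + RB (- t) (RB 0 y))"
        using integrable_RB(2) that by (rule integral_symmetric_interval)
      also have "(\<lambda>t. RB t (RB 0 y) + RB (- t) (RB 0 y)) = (\<lambda>t. 2 *\<^sub>R square_resolvent (t\<^sup>2) y)"
      proof
        fix t
        show "RB t (RB 0 y) + RB (- t) (RB 0 y) = 2 *\<^sub>R square_resolvent (t\<^sup>2) y"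
          unfolding square_resolvent_square RB_commute[of t 0] RB_commute[of "- t" 0]
          using RB_plus_RB[of t y] by (simp only: blinfun.add_right)
      qed
      also have "integral {0..N} \<dots> = 2 *\<^sub>R integral {0..N} (\<lambda>t. square_resolvent (t\<^sup>2) y)" by simp
      also have "integral {0..N} (\<lambda>t. square_resolvent (t\<^sup>2) y) = (integral {0..N} (\<lambda>t. square_resolvent (t\<^sup>2))) y"
        by (rule blinfun_apply_integral[OF integrable_square_resolvent, symmetric])
      finally show ?thesis .
    qed
    then have "\<forall>\<^sub>F N in at_top. 2 *\<^sub>R (integral {0..N} (\<lambda>t. square_resolvent (t\<^sup>2))) y = integral {-N..N} (\<lambda>t. RB t (RB 0 y))"
      by (auto intro: eventually_at_top_linorderI[of 0])
    moreover have "((\<lambda>N. 2 *\<^sub>R (integral {0..N} (\<lambda>t. square_resolvent (t\<^sup>2))) y) \<longlongrightarrow> 2 *\<^sub>R J y) at_top"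
      by (intro tendsto_scaleR blinfun.tendsto tendsto_const J)
    ultimately have "((\<lambda>N. integral {-N..N} (\<lambda>t. RB t (RB 0 y))) \<longlongrightarrow> 2 *\<^sub>R J y) at_top"
      by (rule Lim_transform_eventually[rotated])
    then show "((\<lambda>N. integral {-N..N} (\<lambda>t. RB t (RB 0 y))) \<longlongrightarrow> pi *\<^sub>R (2 / pi) *\<^sub>R J y) at_top"
      by simp
  qed
  have range: "sign_op (sign_op (RB 0 (RB 0 y))) = RB 0 (RB 0 y)" for y
  proof -
    have "sign_op (sign_op (RB 0 (RB 0 y))) = sign_op (RB 0 (sign_op (RB 0 y)))"
      by (simp add: sign_op_RB)
    also have "\<dots> = (2 / pi) *\<^sub>R J ((2 / pi) *\<^sub>R J y)" by (simp only: QJ)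
    also have "\<dots> = ((2 / pi) * (2 / pi)) *\<^sub>R (J o\<^sub>L J) y" by (simp add: blinfun.scaleR_right)
    also have "\<dots> = square_resolvent 0 y" by (simp add: JJ blinfun.scaleR_left power2_eq_square)
    finally show ?thesis using square_resolvent_square[of 0 y] by simp
  qed
  have "closed {x. sign_op (sign_op x) = x}"
    by (intro closed_Collect_eq continuous_intros
        bounded_linear.continuous_on[OF bounded_linear_sign_op])
  moreover have "range (\<lambda>y. RB 0 (RB 0 y)) \<subseteq> {x. sign_op (sign_op x) = x}"
    using range by auto
  ultimately have sub: "closure (range (\<lambda>y. RB 0 (RB 0 y))) \<subseteq> {x. sign_op (sign_op x) = x}"
    by (rule closure_minimal[rotated])
  have ran: "closure (range (RB 0)) = UNIV"
  proof -
    have "op_dom T \<subseteq> range (RB 0)"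
    proof
      fix x assume "x \<in> op_dom T"
      then have "x = RB 0 (op_app T x)" by (simp add: RB_0_op_app)
      then show "x \<in> range (RB 0)" by (rule range_eqI)
    qed
    from closure_mono[OF this] dense show ?thesis by (auto simp: densely_defined_def)
  qed
  have "range (RB 0) = RB 0 ` closure (range (RB 0))" by (simp add: ran)
  also have "\<dots> \<subseteq> closure (RB 0 ` range (RB 0))"
    by (rule image_closure_subset)
      (auto intro: linear_continuous_on blinfun.bounded_linear_right closure_subset[THEN subsetD])
  finally have "range (RB 0) \<subseteq> closure (range (\<lambda>y. RB 0 (RB 0 y)))"
    by (simp add: image_image)
  from closure_minimal[OF this closed_closure] ran
  have "closure (range (\<lambda>y. RB 0 (RB 0 y))) = UNIV" by auto
  with sub show ?thesis by blast
qed

section \<open>The spectral subspaces\<close>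

definition eigenspace :: "real \<Rightarrow> 'a set" where
  "eigenspace \<sigma> = {x. sign_op x = \<sigma> *\<^sub>R x}"

lemma csubspace_eigenspace: "csubspace (eigenspace \<sigma>)"
  by (rule scaleC.subspaceI)
    (simp_all add: eigenspace_def linear_0[OF bounded_linear.linear[OF bounded_linear_sign_op]]
      linear_add[OF bounded_linear.linear[OF bounded_linear_sign_op]] sign_op_scaleC
      scaleC.scale_right_distrib scaleR_scaleC scaleC_scaleC mult.commute)

lemma closed_eigenspace: "closed (eigenspace \<sigma>)"
  unfolding eigenspace_def
  by (intro closed_Collect_eq continuous_intros
      bounded_linear.continuous_on[OF bounded_linear_sign_op])

lemma projection_in_eigenspace:
  assumes "\<sigma> * \<sigma> = 1"
  shows "(1 / 2) *\<^sub>R (x + \<sigma> *\<^sub>R sign_op x) \<in> eigenspace \<sigma>"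
proof -
  note l = bounded_linear.linear[OF bounded_linear_sign_op]
  show ?thesis
    using assms
    by (simp add: eigenspace_def linear_scale[OF l] linear_add[OF l] sign_op_sign_op
        scaleR_add_right add.commute mult.left_commute)
qed

lemma complementary_eigenspaces: "complementary (eigenspace 1) (eigenspace (- 1))"
proof -
  have "eigenspace 1 \<inter> eigenspace (- 1) = {0}"
  proof -
    have "x = 0" if "x = - x" for x :: 'a
    proof -
      have "x + x = 0" using that by (simp add: eq_neg_iff_add_eq_0)
      then show ?thesis using scaleR_half_double[of x] by simp
    qed
    moreover have "0 \<in> eigenspace 1" "0 \<in> eigenspace (- 1)"
      by (simp_all add: scaleC.subspace_0 csubspace_eigenspace)
    ultimately show ?thesis by (auto simp: eigenspace_def)
  qed
  moreover have "{u + w |u w. u \<in> eigenspace 1 \<and> w \<in> eigenspace (- 1)} = UNIV"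
  proof -
    have "\<exists>u w. x = u + w \<and> u \<in> eigenspace 1 \<and> w \<in> eigenspace (- 1)" for x
      using half_plus_half_minus(1)[of x "sign_op x", symmetric]
        projection_in_eigenspace[of 1 x] projection_in_eigenspace[of "- 1" x]
      by (intro exI conjI) simp_all
    then show ?thesis by blast
  qed
  ultimately show ?thesis
    by (simp add: complementary_def csubspace_eigenspace closed_eigenspace)
qed

lemma sign_op_eq_projections:
  "sign_op x = proj_along (eigenspace 1) (eigenspace (- 1)) x
    - proj_along (eigenspace (- 1)) (eigenspace 1) x"
proof -
  have c: "eigenspace 1 \<inter> eigenspace (- 1) = {0}"
    using complementary_eigenspaces by (simp add: complementary_def)
  define u w where "u = (1 / 2) *\<^sub>R (x + 1 *\<^sub>R sign_op x)"
    and "w = (1 / 2) *\<^sub>R (x + (- 1) *\<^sub>R sign_op x)"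
  have "u + w = x" and diff: "u - w = sign_op x"
    unfolding u_def w_def by (rule half_plus_half_minus)+
  then have uw: "x - u = w" "x - w = u" by auto
  have "u \<in> eigenspace 1" "w \<in> eigenspace (- 1)"
    unfolding u_def w_def by (rule projection_in_eigenspace, simp)+
  with uw have "proj_along (eigenspace 1) (eigenspace (- 1)) x = u"
    by (intro proj_along_unique csubspace_eigenspace c) simp_all
  moreover have "proj_along (eigenspace (- 1)) (eigenspace 1) x = w"
    using uw \<open>u \<in> _\<close> \<open>w \<in> _\<close> c
    by (intro proj_along_unique csubspace_eigenspace) (simp_all only: Int_commute)
  ultimately show ?thesis using diff by simp
qed

end

context pv_resolvent
begin

text \<open>Multiplication by \<open>1 / (it - \<mu>)\<close> adds the decay that makes the integral absolutely convergent, hence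
  bounded in \<open>y\<close> with an explicit constant.\<close>

definition shifted_integral :: "complex \<Rightarrow> 'a \<Rightarrow> 'a" where
  "shifted_integral \<mu> y
    = Lim at_top (\<lambda>N. integral {-N..N} (\<lambda>t. (1 / (\<i> * complex_of_real t - \<mu>)) *\<^sub>C RB t y))"

lemma continuous_shifted:
  assumes "Re \<mu> \<noteq> 0"
  shows "continuous_on X (\<lambda>t. (1 / (\<i> * complex_of_real t - \<mu>)) *\<^sub>C RB t y)"
    and "continuous_on X (\<lambda>t. 1 / (\<i> * complex_of_real t - \<mu>))"
proof -
  have "\<i> * complex_of_real t - \<mu> \<noteq> 0" for t
    using assms by (auto simp: complex_eq_iff)
  then show 1: "continuous_on X (\<lambda>t. 1 / (\<i> * complex_of_real t - \<mu>))"
    by (intro continuous_intros) auto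
  show "continuous_on X (\<lambda>t. (1 / (\<i> * complex_of_real t - \<mu>)) *\<^sub>C RB t y)"
    by (intro bounded_bilinear.continuous_on[OF bounded_bilinear_scaleC] 1 continuous_RB_apply)
qed

lemma shifted_integral:
  assumes "Re \<mu> \<noteq> 0"
  shows tendsto_shifted_integral:
      "((\<lambda>N. integral {-N..N} (\<lambda>t. (1 / (\<i> * complex_of_real t - \<mu>)) *\<^sub>C RB t y))
        \<longlongrightarrow> shifted_integral \<mu> y) at_top" (is "(?I \<longlongrightarrow> _) _")
    and norm_shifted_integral_le:
      "norm (shifted_integral \<mu> y) \<le> K * ((1 + \<bar>Im \<mu>\<bar>) / \<bar>Re \<mu>\<bar> + 1) * pi * norm y"
proof -
  define m where "m = (1 + \<bar>Im \<mu>\<bar>) / \<bar>Re \<mu>\<bar> + 1"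
  define f where "f t = (1 / (\<i> * complex_of_real t - \<mu>)) *\<^sub>C RB t y" for t
  have m: "0 \<le> m" by (simp add: m_def)
  have fcont: "continuous_on X f" for X
    unfolding f_def using assms by (rule continuous_shifted)
  have fbd: "norm (f t) \<le> (K * m * norm y) / (1 + t\<^sup>2)" for t
  proof -
    have nz: "0 < cmod (\<i> * complex_of_real t - \<mu>)"
      using assms by (auto simp: complex_eq_iff)
    have "1 / cmod (\<i> * complex_of_real t - \<mu>) \<le> m / (1 + \<bar>t\<bar>)"
    proof -
      have "0 < 1 + \<bar>t\<bar>" "1 + \<bar>t\<bar> \<le> m * cmod (\<i> * complex_of_real t - \<mu>)"
        using one_plus_abs_le_shift[OF assms, of t] by (simp_all add: m_def)
      moreover have "1 / b \<le> m / a" if "0 < a" "0 < b" "a \<le> m * b" for a b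
        using that by (simp add: field_simps)
      ultimately show ?thesis using nz by blast
    qed
    then have "norm (f t) \<le> (m / (1 + \<bar>t\<bar>)) * (K / (1 + \<bar>t\<bar>) * norm y)"
      unfolding f_def norm_scaleC norm_divide norm_one
      using m by (intro mult_mono norm_RB_apply_le) auto
    also have "\<dots> = (K * m * norm y) / ((1 + \<bar>t\<bar>) * (1 + \<bar>t\<bar>))" by simp
    also have "\<dots> \<le> (K * m * norm y) / (1 + t\<^sup>2)"
      using K m by (intro divide_left_mono mult_pos_pos)
        (auto simp: algebra_simps power2_eq_square intro: add_pos_nonneg)
    finally show ?thesis .
  qed
  define g where "g t = f t + f (- t)" for t
  have gcont: "continuous_on X g" for X
    unfolding g_def
    by (intro continuous_intros fcont continuous_on_compose2[OF fcont[of UNIV]]) auto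
  have gint: "g integrable_on {a..b}" for a b
    by (intro integrable_continuous_interval gcont)
  have gbd: "norm (g t) \<le> (2 * K * m * norm y) / (1 + t\<^sup>2)" for t
  proof -
    have "norm (g t) \<le> (K * m * norm y) / (1 + t\<^sup>2) + (K * m * norm y) / (1 + (- t)\<^sup>2)"
      unfolding g_def by (intro norm_triangle_le add_mono fbd)
    also have "\<dots> = (2 * K * m * norm y) / (1 + t\<^sup>2)"
      by (simp only: power2_minus add_divide_distrib[symmetric]) simp
    finally show ?thesis .
  qed
  have Ig: "?I N = integral {0..N} g" if "0 \<le> N" for N
    using integral_symmetric_interval[OF integrable_continuous_interval[OF fcont] that]
    by (simp only: f_def[abs_def, symmetric] g_def[abs_def, symmetric])
  have "\<exists>L. ((\<lambda>N. integral {0..N} g) \<longlongrightarrow> L) at_top"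
  proof (rule improper_integral_power_decay[of _ 1 "2 * K * m * norm y" 2])
    fix t :: real assume t: "1 \<le> t"
    have "(2 * K * m * norm y) / (1 + t\<^sup>2) \<le> (2 * K * m * norm y) / t\<^sup>2"
      using t K m by (intro divide_left_mono mult_pos_pos) (auto intro: add_pos_nonneg)
    with gbd[of t] show "norm (g t) \<le> 2 * K * m * norm y * t powr - 2"
      using t by (simp add: powr_minus divide_inverse)
  qed (use gint in auto)
  then obtain L where L: "((\<lambda>N. integral {0..N} g) \<longlongrightarrow> L) at_top" by blast
  have "\<forall>\<^sub>F N in at_top. integral {0..N} g = ?I N"
    using Ig by (auto intro: eventually_at_top_linorderI[of 0])
  with L have IL: "(?I \<longlongrightarrow> L) at_top" by (rule Lim_transform_eventually)
  then have eq: "shifted_integral \<mu> y = L"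
    unfolding shifted_integral_def by (intro tendsto_Lim) auto
  with IL show "(?I \<longlongrightarrow> shifted_integral \<mu> y) at_top" by simp
  have "norm L \<le> 2 * K * m * norm y * (pi / 2) / sqrt 1"
  proof (rule tendsto_upperbound[OF tendsto_norm[OF L]])
    show "\<forall>\<^sub>F N in at_top. norm (integral {0..N} g) \<le> 2 * K * m * norm y * (pi / 2) / sqrt 1"
      by (rule eventually_at_top_linorderI[of 0]) (intro norm_integral_le_arctan gint gbd, auto)
  qed simp
  then show "norm (shifted_integral \<mu> y) \<le> K * ((1 + \<bar>Im \<mu>\<bar>) / \<bar>Re \<mu>\<bar> + 1) * pi * norm y"
    unfolding eq m_def[symmetric] by (simp add: mult_ac)
qed

lemma shifted_integral_eqI:
  assumes "Re \<mu> \<noteq> 0"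
    and "((\<lambda>N. integral {-N..N} (\<lambda>t. (1 / (\<i> * complex_of_real t - \<mu>)) *\<^sub>C RB t y)) \<longlongrightarrow> w) at_top"
  shows "shifted_integral \<mu> y = w"
  using tendsto_unique[OF trivial_limit_at_top_linorder tendsto_shifted_integral[OF assms(1)] assms(2)] .

lemma shifted_integral_diff:
  assumes "Re \<mu> \<noteq> 0"
  shows "shifted_integral \<mu> (y - w) = shifted_integral \<mu> y - shifted_integral \<mu> w"
proof (rule shifted_integral_eqI[OF assms])
  have "integral {-N..N} (\<lambda>t. (1 / (\<i> * complex_of_real t - \<mu>)) *\<^sub>C RB t (y - w))
      = integral {-N..N} (\<lambda>t. (1 / (\<i> * complex_of_real t - \<mu>)) *\<^sub>C RB t y)
        - integral {-N..N} (\<lambda>t. (1 / (\<i> * complex_of_real t - \<mu>)) *\<^sub>C RB t w)" for N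
    unfolding blinfun.diff_right scaleC.scale_right_diff_distrib
    by (intro Henstock_Kurzweil_Integration.integral_diff integrable_continuous_interval
        continuous_shifted assms)
  then show "((\<lambda>N. integral {-N..N} (\<lambda>t. (1 / (\<i> * complex_of_real t - \<mu>)) *\<^sub>C RB t (y - w)))
      \<longlongrightarrow> shifted_integral \<mu> y - shifted_integral \<mu> w) at_top"
    using tendsto_diff[OF tendsto_shifted_integral tendsto_shifted_integral, OF assms assms] by simp
qed

lemma shifted_integral_commute:
  assumes \<mu>: "Re \<mu> \<noteq> 0" and B: "bounded_linear B"
    and commR: "\<And>t x. RB t (B x) = B (RB t x)" and commC: "\<And>a x. B (a *\<^sub>C x) = a *\<^sub>C B x"
  shows "shifted_integral \<mu> (B y) = B (shifted_integral \<mu> y)"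
proof (rule shifted_integral_eqI[OF \<mu>])
  have "integral {-N..N} (\<lambda>t. (1 / (\<i> * complex_of_real t - \<mu>)) *\<^sub>C RB t (B y))
      = B (integral {-N..N} (\<lambda>t. (1 / (\<i> * complex_of_real t - \<mu>)) *\<^sub>C RB t y))" for N
    using integral_linear[OF integrable_continuous_interval[OF continuous_shifted(1)[OF \<mu>]] B, of "-N" N y]
    by (simp add: o_def commR commC)
  then show "((\<lambda>N. integral {-N..N} (\<lambda>t. (1 / (\<i> * complex_of_real t - \<mu>)) *\<^sub>C RB t (B y)))
      \<longlongrightarrow> B (shifted_integral \<mu> y)) at_top"
    using bounded_linear.tendsto[OF B tendsto_shifted_integral[OF \<mu>]] by simp
qed

text \<open>From \<open>T - \<mu> = (T - it) + (it - \<mu>)\<close> the integrand splits into \<open>x / (it - \<mu>) + R\<^sub>t x\<close>, and each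
  summand has a principal value integral.\<close>

lemma shifted_integral_op_app:
  assumes \<mu>: "Re \<mu> \<noteq> 0" and x: "x \<in> op_dom T"
  shows "shifted_integral \<mu> (op_app T x - \<mu> *\<^sub>C x) = pi *\<^sub>R (sign_op x - sgn (Re \<mu>) *\<^sub>R x)"
proof (rule shifted_integral_eqI[OF \<mu>])
  let ?c = "\<lambda>t. 1 / (\<i> * complex_of_real t - \<mu>)"
  have split: "?c t *\<^sub>C RB t (op_app T x - \<mu> *\<^sub>C x) = ?c t *\<^sub>C x + RB t x" for t
  proof -
    let ?d = "\<i> * complex_of_real t - \<mu>"
    have d: "?d \<noteq> 0" using \<mu> by (auto simp: complex_eq_iff)
    have "op_app T x - \<mu> *\<^sub>C x = (op_app T x - (\<i> * complex_of_real t) *\<^sub>C x) + ?d *\<^sub>C x"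
      by (simp add: scaleC.scale_left_diff_distrib)
    then have "RB t (op_app T x - \<mu> *\<^sub>C x) = x + ?d *\<^sub>C RB t x"
      by (simp only: blinfun.add_right RB_shift[OF x] RB_scaleC)
    then show ?thesis using d by (simp add: scaleC.scale_right_distrib)
  qed
  have ci: "?c integrable_on {-N..N}" for N
    by (intro integrable_continuous_interval continuous_shifted(2) \<mu>)
  have bl: "bounded_linear (\<lambda>a. a *\<^sub>C x)"
    by (rule bounded_bilinear.bounded_linear_left[OF bounded_bilinear_scaleC])
  have "integral {-N..N} (\<lambda>t. ?c t *\<^sub>C RB t (op_app T x - \<mu> *\<^sub>C x))
      = integral {-N..N} ?c *\<^sub>C x + integral {-N..N} (\<lambda>t. RB t x)" for N
  proof -
    have 1: "((\<lambda>t. ?c t *\<^sub>C x) has_integral integral {-N..N} ?c *\<^sub>C x) {-N..N}"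
      using has_integral_linear[OF integrable_integral[OF ci] bl] by (simp add: o_def)
    have 2: "((\<lambda>t. RB t x) has_integral integral {-N..N} (\<lambda>t. RB t x)) {-N..N}"
      by (rule integrable_integral[OF integrable_RB(2)])
    show ?thesis unfolding split by (rule integral_unique[OF has_integral_add[OF 1 2]])
  qed
  moreover have "((\<lambda>N. integral {-N..N} ?c *\<^sub>C x + integral {-N..N} (\<lambda>t. RB t x))
      \<longlongrightarrow> complex_of_real (- pi * sgn (Re \<mu>)) *\<^sub>C x + pi *\<^sub>R sign_op x) at_top"
    by (intro tendsto_add bounded_linear.tendsto[OF bl] pv_integral_inverse_shift \<mu> tendsto_sign_op)
  moreover have "complex_of_real (- pi * sgn (Re \<mu>)) *\<^sub>C x + pi *\<^sub>R sign_op x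
      = pi *\<^sub>R (sign_op x - sgn (Re \<mu>) *\<^sub>R x)"
    unfolding scaleR_scaleC[symmetric] by (simp add: scaleR_diff_right)
  ultimately show "((\<lambda>N. integral {-N..N} (\<lambda>t. ?c t *\<^sub>C RB t (op_app T x - \<mu> *\<^sub>C x)))
      \<longlongrightarrow> pi *\<^sub>R (sign_op x - sgn (Re \<mu>) *\<^sub>R x)) at_top"
    by simp
qed

lemma RB_eigenspace: "x \<in> eigenspace \<sigma> \<Longrightarrow> RB t x \<in> eigenspace \<sigma>"
  by (simp add: eigenspace_def sign_op_RB blinfun.scaleR_right)

lemma op_app_eigenspace: "x \<in> op_dom T \<Longrightarrow> x \<in> eigenspace \<sigma> \<Longrightarrow> op_app T x \<in> eigenspace \<sigma>"
  using sign_op_in_dom(2)[of x]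
  by (simp add: eigenspace_def scaleR_scaleC linear_operatorD[OF lin])

lemma resolvent_set_eigenspace_imaginary:
  "\<i> * complex_of_real t \<in> resolvent_set_in (eigenspace \<sigma>) (op_restrict T (eigenspace \<sigma>))"
proof (rule resolvent_set_inI)
  show "linear_operator (op_restrict T (eigenspace \<sigma>))"
    by (intro linear_operator_restrict lin csubspace_eigenspace)
  show "bounded_below (op_restrict T (eigenspace \<sigma>)) (\<i> * complex_of_real t) (K / (1 + \<bar>t\<bar>))"
    using below[of t] by (simp add: bounded_below_def)
  show "op_app (op_restrict T (eigenspace \<sigma>)) x - (\<i> * complex_of_real t) *\<^sub>C x \<in> eigenspace \<sigma>"
    if "x \<in> op_dom (op_restrict T (eigenspace \<sigma>))" for x
    using that
    by (simp add: scaleC.subspace_diff scaleC.subspace_scale csubspace_eigenspace op_app_eigenspace)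
  show "\<exists>x\<in>op_dom (op_restrict T (eigenspace \<sigma>)).
      op_app (op_restrict T (eigenspace \<sigma>)) x - (\<i> * complex_of_real t) *\<^sub>C x = y"
    if "y \<in> eigenspace \<sigma>" for y
    using that by (intro bexI[of _ "RB t y"]) (simp_all add: op_app_RB RB_in_dom RB_eigenspace)
qed

text \<open>On this eigenspace \<open>shifted_integral\<close> is, up to the factor \<open>2 \<pi> \<sigma>\<close>, a left inverse of \<open>T - \<mu>\<close>, which
  yields the lower estimate. For surjectivity, its value \<open>k\<close> at \<open>y\<close>, suitably scaled, is a candidate
  for the preimage, but not visibly in the domain of \<open>T\<close>. The left inverse property at the point
  \<open>T\<^sup>-\<^sup>1 y\<close> of the domain reads \<open>k - \<mu> T\<^sup>-\<^sup>1 k = T\<^sup>-\<^sup>1 y\<close>, which shows that \<open>k\<close> lies in the domain and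
  solves the equation.\<close>

lemma resolvent_set_eigenspace_off_axis:
  assumes \<mu>: "Re \<mu> \<noteq> 0" and \<sigma>: "\<sigma> = - sgn (Re \<mu>)"
  shows "\<mu> \<in> resolvent_set_in (eigenspace \<sigma>) (op_restrict T (eigenspace \<sigma>))"
proof -
  have \<sigma>\<sigma>: "\<sigma> * \<sigma> = 1" using \<mu> by (simp add: \<sigma> sgn_if)
  define c where "c = 2 * pi * \<sigma>"
  have c: "c \<noteq> 0" using \<mu> by (simp add: c_def \<sigma> sgn_zero_iff)
  have left: "shifted_integral \<mu> (op_app T x - \<mu> *\<^sub>C x) = c *\<^sub>R x"
    if "x \<in> op_dom T" "x \<in> eigenspace \<sigma>" for x
  proof -
    have "shifted_integral \<mu> (op_app T x - \<mu> *\<^sub>C x) = pi *\<^sub>R (\<sigma> *\<^sub>R x - sgn (Re \<mu>) *\<^sub>R x)"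
      using shifted_integral_op_app[OF \<mu> that(1)] that(2) by (simp add: eigenspace_def)
    also have "\<dots> = (pi * (\<sigma> - sgn (Re \<mu>))) *\<^sub>R x"
      by (simp only: scaleR_left_diff_distrib[symmetric] scaleR_scaleR)
    finally show ?thesis by (simp add: c_def \<sigma>)
  qed
  show ?thesis
  proof (rule resolvent_set_inI)
    show "linear_operator (op_restrict T (eigenspace \<sigma>))"
      by (intro linear_operator_restrict lin csubspace_eigenspace)
    let ?C = "K * ((1 + \<bar>Im \<mu>\<bar>) / \<bar>Re \<mu>\<bar> + 1) * pi"
    show "bounded_below (op_restrict T (eigenspace \<sigma>)) \<mu> (?C / \<bar>c\<bar>)"
      unfolding bounded_below_def
    proof
      fix x assume "x \<in> op_dom (op_restrict T (eigenspace \<sigma>))"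
      then have "\<bar>c\<bar> * norm x \<le> ?C * norm (op_app T x - \<mu> *\<^sub>C x)"
        using norm_shifted_integral_le[OF \<mu>, of "op_app T x - \<mu> *\<^sub>C x"] left[of x] by simp
      then show "norm x \<le> ?C / \<bar>c\<bar> * norm (op_app (op_restrict T (eigenspace \<sigma>)) x - \<mu> *\<^sub>C x)"
        using c by (simp add: field_simps)
    qed
    show "op_app (op_restrict T (eigenspace \<sigma>)) x - \<mu> *\<^sub>C x \<in> eigenspace \<sigma>"
      if "x \<in> op_dom (op_restrict T (eigenspace \<sigma>))" for x
      using that
      by (simp add: scaleC.subspace_diff scaleC.subspace_scale csubspace_eigenspace op_app_eigenspace)
    fix y assume y: "y \<in> eigenspace \<sigma>"
    define k where "k = (1 / c) *\<^sub>R shifted_integral \<mu> y"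
    have "k - \<mu> *\<^sub>C RB 0 k = RB 0 y"
    proof -
      have comm: "shifted_integral \<mu> (RB 0 x) = RB 0 (shifted_integral \<mu> x)" for x
        by (rule shifted_integral_commute[OF \<mu> blinfun.bounded_linear_right RB_commute RB_scaleC])
      have commC: "shifted_integral \<mu> (a *\<^sub>C x) = a *\<^sub>C shifted_integral \<mu> x" for a x
        by (rule shifted_integral_commute[OF \<mu> bounded_linear_scaleC RB_scaleC])
          (simp add: scaleC_scaleC mult.commute)
      have "c *\<^sub>R RB 0 y = shifted_integral \<mu> (y - \<mu> *\<^sub>C RB 0 y)"
        using left[OF RB_in_dom[of 0 y] RB_eigenspace[OF y]] op_app_RB[of 0 y] by simp
      also have "\<dots> = shifted_integral \<mu> y - \<mu> *\<^sub>C RB 0 (shifted_integral \<mu> y)"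
        by (simp add: shifted_integral_diff[OF \<mu>] comm commC)
      finally have "(1 / c) *\<^sub>R c *\<^sub>R RB 0 y
          = (1 / c) *\<^sub>R (shifted_integral \<mu> y - \<mu> *\<^sub>C RB 0 (shifted_integral \<mu> y))" by simp
      then show ?thesis
        using c by (simp add: k_def scaleR_diff_right blinfun.scaleR_right)
          (simp add: scaleR_scaleC scaleC_scaleC mult.commute)
    qed
    then have k: "k = RB 0 (y + \<mu> *\<^sub>C k)"
      by (simp add: blinfun.add_right RB_scaleC algebra_simps)
    then have kd: "k \<in> op_dom T" using RB_in_dom by metis
    have Tk: "op_app T k = y + \<mu> *\<^sub>C k" using op_app_RB[of 0 "y + \<mu> *\<^sub>C k"] k by simp
    \<comment> \<open>The projection of \<open>k\<close> still solves the equation, as \<open>y\<close> is left fixed, and lies in the eigenspace.\<close>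
    define x where "x = (1 / 2) *\<^sub>R (k + \<sigma> *\<^sub>R sign_op k)"
    have sd: "sign_op k \<in> op_dom T" "op_app T (sign_op k) = sign_op y + \<mu> *\<^sub>C sign_op k"
      using sign_op_in_dom[OF kd] Tk
      by (simp_all add: linear_add[OF bounded_linear.linear[OF bounded_linear_sign_op]] sign_op_scaleC)
    have xd: "x \<in> op_dom T"
      unfolding x_def scaleR_scaleC by (intro linear_operatorD[OF lin] kd sd)
    have "op_app T x - \<mu> *\<^sub>C x
        = (1 / 2) *\<^sub>R ((op_app T k - \<mu> *\<^sub>C k) + \<sigma> *\<^sub>R (op_app T (sign_op k) - \<mu> *\<^sub>C sign_op k))"
      unfolding x_def scaleR_scaleC
      by (simp only: shift_scaleC[OF lin] shift_add[OF lin] linear_operatorD(3,5)[OF lin] kd sd(1))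
    also have "\<dots> = (1 / 2) *\<^sub>R (y + \<sigma> *\<^sub>R sign_op y)" by (simp add: Tk sd)
    also have "sign_op y = \<sigma> *\<^sub>R y" using y by (simp add: eigenspace_def)
    also have "(1 / 2) *\<^sub>R (y + \<sigma> *\<^sub>R \<sigma> *\<^sub>R y) = y" by (simp add: \<sigma>\<sigma>)
    finally show "\<exists>x\<in>op_dom (op_restrict T (eigenspace \<sigma>)).
        op_app (op_restrict T (eigenspace \<sigma>)) x - \<mu> *\<^sub>C x = y"
      using xd projection_in_eigenspace[OF \<sigma>\<sigma>, of k] by (intro bexI[of _ x]) (simp_all add: x_def)
  qed
qed

lemma spectrum_eigenspaces:
  "spectrum_in (eigenspace 1) (op_restrict T (eigenspace 1)) \<subseteq> {z. Re z > 0}"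
  "spectrum_in (eigenspace (- 1)) (op_restrict T (eigenspace (- 1))) \<subseteq> {z. Re z < 0}"
proof -
  have zero: "\<mu> \<in> resolvent_set_in (eigenspace \<sigma>) (op_restrict T (eigenspace \<sigma>))" if "Re \<mu> = 0" for \<mu> \<sigma>
  proof -
    have "\<mu> = \<i> * complex_of_real (Im \<mu>)" using that by (simp add: complex_eq_iff)
    then show ?thesis using resolvent_set_eigenspace_imaginary[of "Im \<mu>" \<sigma>] by simp
  qed
  have "\<mu> \<in> resolvent_set_in (eigenspace 1) (op_restrict T (eigenspace 1))" if "Re \<mu> \<le> 0" for \<mu>
    using that zero[of \<mu> 1] resolvent_set_eigenspace_off_axis[of \<mu> 1] by (cases "Re \<mu> = 0") auto
  then show "spectrum_in (eigenspace 1) (op_restrict T (eigenspace 1)) \<subseteq> {z. Re z > 0}"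
    unfolding spectrum_in_def by (blast intro: not_le_imp_less)
  have "\<mu> \<in> resolvent_set_in (eigenspace (- 1)) (op_restrict T (eigenspace (- 1)))" if "Re \<mu> \<ge> 0" for \<mu>
    using that zero[of \<mu> "- 1"] resolvent_set_eigenspace_off_axis[of \<mu> "- 1"] by (cases "Re \<mu> = 0") auto
  then show "spectrum_in (eigenspace (- 1)) (op_restrict T (eigenspace (- 1))) \<subseteq> {z. Re z < 0}"
    unfolding spectrum_in_def by (blast intro: not_le_imp_less)
qed

end

section \<open>A neighbourhood of the imaginary axis\<close>

context imaginary_axis_resolvent
begin

text \<open>A horizontal shift by \<open>Re z\<close> changes \<open>T - i Im z\<close> by a multiple of the identity that is relatively
  smaller than \<open>1 / 2\<close> as long as \<open>|Re z|\<close> is small compared with \<open>1 + |Im z|\<close>; this describes a strip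
  and a bisector at the same time.\<close>

lemma resolvent_near_axis:
  assumes "2 * K * \<bar>Re z\<bar> \<le> 1 + \<bar>Im z\<bar>"
  shows "z \<in> resolvent_set T" and "bounded_below T z (2 * K / (1 + \<bar>Im z\<bar>))"
proof -
  have small: "norm ((op_app T x - z *\<^sub>C x) - (op_app T x - (\<i> * complex_of_real (Im z)) *\<^sub>C x))
      \<le> 1 / 2 * norm (op_app T x - (\<i> * complex_of_real (Im z)) *\<^sub>C x)" if x: "x \<in> op_dom T" for x
  proof -
    let ?n = "norm (op_app T x - (\<i> * complex_of_real (Im z)) *\<^sub>C x)"
    have "(op_app T x - z *\<^sub>C x) - (op_app T x - (\<i> * complex_of_real (Im z)) *\<^sub>C x)
        = (\<i> * complex_of_real (Im z) - z) *\<^sub>C x"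
      by (simp add: scaleC.scale_left_diff_distrib)
    also have "\<i> * complex_of_real (Im z) - z = complex_of_real (- Re z)"
      by (rule complex_eqI) simp_all
    finally have "norm ((op_app T x - z *\<^sub>C x) - (op_app T x - (\<i> * complex_of_real (Im z)) *\<^sub>C x))
        = \<bar>Re z\<bar> * norm x" by (simp add: norm_scaleC)
    also have "\<dots> \<le> \<bar>Re z\<bar> * (K / (1 + \<bar>Im z\<bar>) * ?n)"
      using below[of "Im z"] x by (intro mult_left_mono) (auto simp: bounded_below_def)
    also have "\<dots> = (\<bar>Re z\<bar> * K / (1 + \<bar>Im z\<bar>)) * ?n" by simp
    also have "\<dots> \<le> 1 / 2 * ?n"
      using assms by (intro mult_right_mono) (simp_all add: divide_le_eq mult_ac add_pos_nonneg)
    finally show ?thesis .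
  qed
  have m: "0 \<le> K / (1 + \<bar>Im z\<bar>)" using K by simp
  note perturb = resolvent_set_perturb[OF lin lin refl res below small _ _ m]
  show "z \<in> resolvent_set T" by (rule perturb) auto
  have "bounded_below T z (K / (1 + \<bar>Im z\<bar>) / (1 - 1 / 2))" by (rule perturb) auto
  then show "bounded_below T z (2 * K / (1 + \<bar>Im z\<bar>))" by (simp add: mult.commute)
qed

lemma strip_in_resolvent_set: "\<exists>h>0. {z. \<bar>Re z\<bar> < h} \<subseteq> resolvent_set T"
proof (intro exI conjI subsetI)
  show "0 < 1 / (2 * K + 1)" using K by simp
  fix z assume "z \<in> {z. \<bar>Re z\<bar> < 1 / (2 * K + 1)}"
  then have "\<bar>Re z\<bar> * (2 * K + 1) < 1" using K by (simp add: field_simps)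
  then have "2 * K * \<bar>Re z\<bar> \<le> 1 + \<bar>Im z\<bar>" by (simp add: algebra_simps)
  then show "z \<in> resolvent_set T" by (rule resolvent_near_axis)
qed

end

theorem (in pv_resolvent) dichotomous_wrt_eigenspaces:
  "dichotomous_wrt T (eigenspace 1) (eigenspace (- 1))"
  using lin dense complementary_eigenspaces strip_in_resolvent_set spectrum_eigenspaces
    op_app_eigenspace
  by (auto simp: dichotomous_wrt_def)

section \<open>Bisectors\<close>

lemma Omega_Re_Im_bounds:
  assumes "z \<in> Omega \<phi> \<rho>" "0 \<le> \<rho>" "0 \<le> \<phi>" "\<phi> \<le> pi / 2"
  shows "\<bar>Re z\<bar> \<le> cmod z * cos \<phi>" and "cmod z * sin \<phi> \<le> \<bar>Im z\<bar>"
proof -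
  have z: "\<phi> \<le> \<bar>Arg z\<bar>" "\<bar>Arg z\<bar> \<le> pi - \<phi>" "z \<noteq> 0"
    using assms by (auto simp: Omega_def)
  have "cos \<bar>Arg z\<bar> \<le> cos \<phi>" using z assms by (intro cos_monotone_0_pi_le) auto
  moreover have "cos (pi - \<phi>) \<le> cos \<bar>Arg z\<bar>" using z assms by (intro cos_monotone_0_pi_le) auto
  ultimately have c: "\<bar>cos (Arg z)\<bar> \<le> cos \<phi>" by (simp add: abs_le_iff)
  then show "\<bar>Re z\<bar> \<le> cmod z * cos \<phi>"
    using z(3) by (simp add: cos_Arg divide_le_eq mult.commute)
  have "0 \<le> cos \<phi>" using c by linarith
  with c have "(cos (Arg z))\<^sup>2 \<le> (cos \<phi>)\<^sup>2" by (simp add: abs_le_square_iff[symmetric])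
  then have "(sin \<phi>)\<^sup>2 \<le> (sin (Arg z))\<^sup>2" by (simp add: sin_squared_eq)
  then have "sin \<phi> \<le> \<bar>sin (Arg z)\<bar>" by (simp add: abs_le_square_iff[symmetric])
  then show "cmod z * sin \<phi> \<le> \<bar>Im z\<bar>"
    using z(3) by (simp add: sin_Arg le_divide_eq mult.commute)
qed

lemma imaginary_in_Omega:
  assumes "\<phi> \<le> pi / 2" "\<rho> < \<bar>t\<bar>" "0 \<le> \<rho>"
  shows "\<i> * complex_of_real t \<in> Omega \<phi> \<rho>"
proof -
  have "Arg (\<i> * complex_of_real t) = (if 0 < t then pi / 2 else - pi / 2)"
  proof (cases "0 < t")
    case True
    then show ?thesis by simp
  next
    case False
    with assms have "0 < - t" by linarith
    moreover have "\<i> * complex_of_real t = (- \<i>) * complex_of_real (- t)" by simp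
    ultimately have "Arg (\<i> * complex_of_real t) = Arg (- \<i>)"
      by (metis Arg_times_of_real2)
    then show ?thesis using False by simp
  qed
  then show ?thesis using assms by (auto simp: Omega_def norm_mult)
qed

lemma not_Omega_in_bisector:
  assumes "z \<notin> Omega \<phi> \<rho>" "\<phi> < pi / 2"
  shows "z \<in> sector \<phi> \<union> uminus ` sector \<phi> \<union> {z. cmod z \<le> \<rho>}"
proof (cases "\<bar>Arg z\<bar> < \<phi> \<or> cmod z \<le> \<rho>")
  case False
  with assms have far: "pi - \<phi> < \<bar>Arg z\<bar>" by (auto simp: Omega_def)
  have "z \<noteq> 0" using far assms(2) by (auto simp: Arg_zero) (use pi_gt_zero in linarith)
  then have "\<bar>Arg (- z)\<bar> \<le> \<phi>"
    using far Arg_bounded[of z] by (auto simp: Arg_minus)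
  then have "- z \<in> sector \<phi>" by (simp add: sector_def)
  then show ?thesis by (metis UnI1 UnI2 image_eqI minus_minus)
qed (auto simp: sector_def)

lemma Omega_avoids_bisector:
  assumes "z \<in> Omega \<phi> \<rho>" "\<theta> < \<phi>" "\<phi> \<le> pi / 2" "0 \<le> \<rho>"
  shows "z \<notin> sector \<theta> \<union> uminus ` sector \<theta> \<union> {z. cmod z \<le> \<rho>}"
proof -
  have z: "\<phi> \<le> \<bar>Arg z\<bar>" "\<bar>Arg z\<bar> \<le> pi - \<phi>" "\<rho> < cmod z" "z \<noteq> 0"
    using assms by (auto simp: Omega_def)
  have "- z \<notin> sector \<theta>"
    using z assms Arg_bounded[of z] by (auto simp: sector_def Arg_minus)
  then have "z \<notin> uminus ` sector \<theta>" by auto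
  with z assms show ?thesis by (auto simp: sector_def)
qed

text \<open>An estimate on the closed bisector \<open>Omega \<phi> \<rho>\<close> is inherited by all narrower ones, with the same
  constant.\<close>

lemma bisectorialI:
  fixes T :: "'a::complex_normed_vector operator"
  assumes "linear_operator T" "densely_defined T" "0 \<le> \<phi>" "\<phi> < pi / 2" "0 \<le> \<rho>" "0 < M"
    and res: "\<And>z. z \<in> Omega \<phi> \<rho> \<Longrightarrow> z \<in> resolvent_set T"
    and below: "\<And>z. z \<in> Omega \<phi> \<rho> \<Longrightarrow> bounded_below T z (M / cmod z)"
  shows "bisectorial T \<phi> \<rho>"
proof -
  have "spectrum T \<subseteq> sector \<phi> \<union> uminus ` sector \<phi> \<union> {z. cmod z \<le> \<rho>}"
    using res not_Omega_in_bisector[OF _ assms(4)] by (force simp: spectrum_in_def)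
  moreover have "onorm (resolvent T z) \<le> M / cmod z" if "\<phi> < \<phi>'" "z \<in> Omega \<phi>' \<rho>" for \<phi>' z
  proof -
    have z: "z \<in> Omega \<phi> \<rho>" using that by (auto simp: Omega_def)
    show ?thesis
      by (rule onorm_bound) (use assms(6) norm_resolvent_le[OF res[OF z] below[OF z]] in auto)
  qed
  ultimately show ?thesis using assms unfolding bisectorial_def by blast
qed

lemma bisectorialD:
  assumes "bisectorial T \<theta> \<rho>" "\<theta> < \<phi>" "\<phi> \<le> pi / 2"
  obtains M where "0 < M" "\<And>z. z \<in> Omega \<phi> \<rho> \<Longrightarrow> z \<in> resolvent_set T"
    "\<And>z. z \<in> Omega \<phi> \<rho> \<Longrightarrow> bounded_below T z (M / cmod z)"
proof -
  have lin: "linear_operator T" and \<rho>: "0 \<le> \<rho>"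
    and sp: "spectrum T \<subseteq> sector \<theta> \<union> uminus ` sector \<theta> \<union> {z. cmod z \<le> \<rho>}"
    using assms by (auto simp: bisectorial_def)
  obtain M where M: "0 < M" "\<And>z. z \<in> Omega \<phi> \<rho> \<Longrightarrow> onorm (resolvent T z) \<le> M / cmod z"
    using assms by (auto simp: bisectorial_def)
  have res: "z \<in> resolvent_set T" if "z \<in> Omega \<phi> \<rho>" for z
    using Omega_avoids_bisector[OF that assms(2,3) \<rho>] sp by (auto simp: spectrum_in_def)
  show thesis
    by (rule that[OF M(1) res]) (auto intro: bounded_belowI_onorm lin res M(2))
qed

lemma (in imaginary_axis_resolvent) bisectorial_near_axis:
  assumes "0 \<le> \<theta>" "\<theta> < pi / 2"
  obtains \<phi> where "\<theta> < \<phi>" "\<phi> < pi / 2" "bisectorial T \<phi> 0" "Omega \<phi> 0 \<subseteq> resolvent_set T"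
proof -
  \<comment> \<open>Above \<open>arctan (2 K)\<close>, the bisector lies in the region controlled by \<open>resolvent_near_axis\<close>.\<close>
  define \<phi> where "\<phi> = (max \<theta> (arctan (2 * K)) + pi / 2) / 2"
  have b: "\<theta> < \<phi>" "arctan (2 * K) < \<phi>" "\<phi> < pi / 2" "0 < \<phi>"
    using assms arctan_ubound[of "2 * K"] by (auto simp: \<phi>_def)
  have c: "0 < cos \<phi>" and s: "0 < sin \<phi>" using b by (auto intro: cos_gt_zero sin_gt_zero)
  have "2 * K < tan \<phi>"
    using tan_monotone[of "arctan (2 * K)" \<phi>] b arctan_lbound[of "2 * K"] by (simp add: tan_arctan)
  then have K2: "2 * K * cos \<phi> \<le> sin \<phi>" using c by (simp add: tan_def less_divide_eq)
  have near: "2 * K * \<bar>Re z\<bar> \<le> 1 + \<bar>Im z\<bar>" and im: "cmod z * sin \<phi> \<le> \<bar>Im z\<bar>" and nz: "0 < cmod z"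
    if "z \<in> Omega \<phi> 0" for z
  proof -
    note bounds = Omega_Re_Im_bounds[OF that order_refl less_imp_le[OF b(4)] less_imp_le[OF b(3)]]
    show "cmod z * sin \<phi> \<le> \<bar>Im z\<bar>" by (rule bounds)
    show "0 < cmod z" using that by (simp add: Omega_def)
    have "2 * K * \<bar>Re z\<bar> \<le> 2 * K * (cmod z * cos \<phi>)" using K bounds by (intro mult_left_mono) auto
    also have "\<dots> \<le> cmod z * sin \<phi>" using mult_left_mono[OF K2, of "cmod z"] by (simp add: mult_ac)
    also have "\<dots> \<le> 1 + \<bar>Im z\<bar>" using bounds by linarith
    finally show "2 * K * \<bar>Re z\<bar> \<le> 1 + \<bar>Im z\<bar>" .
  qed
  have below': "bounded_below T z ((2 * K / sin \<phi> + 1) / cmod z)" if z: "z \<in> Omega \<phi> 0" for z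
  proof (rule bounded_below_mono[OF resolvent_near_axis(2)[OF near[OF z]]])
    have "2 * K / (1 + \<bar>Im z\<bar>) \<le> 2 * K / (cmod z * sin \<phi>)"
      using K s nz[OF z] im[OF z] by (intro divide_left_mono mult_pos_pos) auto
    also have "\<dots> = (2 * K / sin \<phi>) / cmod z" by simp
    also have "\<dots> \<le> (2 * K / sin \<phi> + 1) / cmod z" by (intro divide_right_mono) auto
    finally show "2 * K / (1 + \<bar>Im z\<bar>) \<le> (2 * K / sin \<phi> + 1) / cmod z" .
  qed
  have "bisectorial T \<phi> 0"
    by (rule bisectorialI[where M = "2 * K / sin \<phi> + 1"])
      (use lin dense b K s near below' resolvent_near_axis(1) in \<open>auto intro: add_nonneg_pos\<close>)
  moreover have "Omega \<phi> 0 \<subseteq> resolvent_set T" using near resolvent_near_axis(1) by blast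
  ultimately show thesis using that b by blast
qed

section \<open>Subordinate perturbations\<close>

lemma op_plus_simps:
  assumes "op_dom S \<subseteq> op_dom R"
  shows "op_dom (op_plus S R) = op_dom S" and "op_app (op_plus S R) x = op_app S x + op_app R x"
  using assms by (auto simp: op_plus_def)

lemma linear_operator_op_plus:
  assumes "linear_operator S" "linear_operator R" "op_dom S \<subseteq> op_dom R"
  shows "linear_operator (op_plus S R)"
proof -
  have "x \<in> op_dom R" if "x \<in> op_dom S" for x using that assms(3) by blast
  moreover have "csubspace (op_dom S)" using assms(1) by (simp add: linear_operator_def)
  ultimately show ?thesis
    unfolding linear_operator_def[of "op_plus S R"]
    using linear_operatorD(4,6)[OF assms(1)] linear_operatorD(4,6)[OF assms(2)]
    by (simp add: op_plus_simps[OF assms(3)] scaleC.scale_right_distrib)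
qed

text \<open>Let \<open>n\<close> be the norm of \<open>(S - z) x\<close>. The resolvent estimate bounds \<open>x\<close> by \<open>M n / |z|\<close>, and
  \<open>S x = (S - z) x + z x\<close> by \<open>(1 + M) n\<close>. The exponents \<open>1 - p\<close> and \<open>p\<close> add up to one, so subordination
  bounds \<open>R x\<close> by a multiple of \<open>|z|\<^sup>p\<^sup>-\<^sup>1 n\<close>.\<close>

lemma subordinate_small_on_bisector:
  assumes bis: "bisectorial S \<theta> r" and sub: "p_subordinate p R S" and p: "p < 1"
    and \<phi>: "\<theta> < \<phi>" "\<phi> \<le> pi / 2"
  obtains M C where "0 < M" "0 \<le> C"
    and "\<And>z. z \<in> Omega \<phi> r \<Longrightarrow> z \<in> resolvent_set S"
    and "\<And>z. z \<in> Omega \<phi> r \<Longrightarrow> bounded_below S z (M / cmod z)"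
    and "\<And>z x. z \<in> Omega \<phi> r \<Longrightarrow> x \<in> op_dom S \<Longrightarrow>
      norm (op_app R x) \<le> C * cmod z powr (p - 1) * norm (op_app S x - z *\<^sub>C x)"
proof -
  obtain M where M: "0 < M" and res: "\<And>z. z \<in> Omega \<phi> r \<Longrightarrow> z \<in> resolvent_set S"
    and below: "\<And>z. z \<in> Omega \<phi> r \<Longrightarrow> bounded_below S z (M / cmod z)"
    using bisectorialD[OF bis \<phi>] by blast
  have r: "0 \<le> r" using bis by (simp add: bisectorial_def)
  obtain c where p0: "0 \<le> p" and c: "0 \<le> c" and cR: "\<And>x. x \<in> op_dom S \<Longrightarrow>
      norm (op_app R x) \<le> c * rpow (norm x) (1 - p) * rpow (norm (op_app S x)) p"
    using sub by (auto simp: p_subordinate_def)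
  define C where "C = c * (M powr (1 - p) * (1 + M) powr p)"
  have "norm (op_app R x) \<le> C * cmod z powr (p - 1) * norm (op_app S x - z *\<^sub>C x)"
    if z: "z \<in> Omega \<phi> r" and x: "x \<in> op_dom S" for z x
  proof -
    define n where "n = norm (op_app S x - z *\<^sub>C x)"
    have zpos: "0 < cmod z" using z r unfolding Omega_def mem_Collect_eq by linarith
    have n: "0 \<le> n" by (simp add: n_def)
    have nx: "norm x \<le> M / cmod z * n" using below[OF z] x by (simp add: bounded_below_def n_def)
    have "norm (op_app S x) \<le> n + norm (z *\<^sub>C x)"
      unfolding n_def by (metis add.commute norm_triangle_sub)
    also have "norm (z *\<^sub>C x) \<le> cmod z * (M / cmod z * n)"
      unfolding norm_scaleC using nx by (intro mult_left_mono) auto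
    also have "cmod z * (M / cmod z * n) = M * n" using zpos by simp
    finally have nS: "norm (op_app S x) \<le> (1 + M) * n" by (simp add: algebra_simps)
    have a: "rpow (norm x) (1 - p) \<le> (M powr (1 - p) * cmod z powr (p - 1)) * n powr (1 - p)"
    proof -
      have "rpow (norm x) (1 - p) = norm x powr (1 - p)" using p by (simp add: rpow_def)
      also have "\<dots> \<le> (M / cmod z * n) powr (1 - p)" using nx p by (intro powr_mono2) auto
      also have "\<dots> = M powr (1 - p) / cmod z powr (1 - p) * n powr (1 - p)"
        using M zpos n by (simp add: powr_mult powr_divide)
      also have "1 / cmod z powr (1 - p) = cmod z powr (p - 1)"
        using powr_minus_divide[of "cmod z" "1 - p"] by simp
      then have "M powr (1 - p) / cmod z powr (1 - p) = M powr (1 - p) * cmod z powr (p - 1)"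
        by (metis times_divide_eq_right mult.right_neutral)
      finally show ?thesis .
    qed
    have b: "rpow (norm (op_app S x)) p \<le> (1 + M) powr p * rpow n p"
    proof (cases "p = 0")
      case False
      then have "norm (op_app S x) powr p \<le> ((1 + M) * n) powr p"
        using nS p0 by (intro powr_mono2) auto
      with False show ?thesis using M n by (simp add: rpow_def powr_mult)
    qed (use M in \<open>simp add: rpow_def\<close>)
    have rp: "0 \<le> rpow u q" if "0 \<le> u" for u q by (simp add: rpow_def)
    have nn: "n powr (1 - p) * rpow n p = n"
    proof (cases "p = 0")
      case True
      then show ?thesis using n by (simp add: rpow_def)
    next
      case False
      then show ?thesis using n by (cases "n = 0") (simp_all add: rpow_def flip: powr_add)
    qed
    have "norm (op_app R x) \<le> c * rpow (norm x) (1 - p) * rpow (norm (op_app S x)) p" by (rule cR[OF x])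
    also have "\<dots> \<le> c * ((M powr (1 - p) * cmod z powr (p - 1)) * n powr (1 - p)) * ((1 + M) powr p * rpow n p)"
      using c rp n by (intro mult_mono a b mult_nonneg_nonneg) auto
    also have "\<dots> = C * cmod z powr (p - 1) * (n powr (1 - p) * rpow n p)" by (simp add: C_def)
    finally show ?thesis unfolding nn by (simp only: n_def)
  qed
  moreover have "0 \<le> C" using c by (simp add: C_def)
  ultimately show thesis using that M res below by blast
qed

lemma perturbed_bisector:
  fixes S R :: "'a::complex_banach operator"
  assumes lin: "linear_operator S" "linear_operator R" and dom: "op_dom S \<subseteq> op_dom R"
    and r: "0 \<le> r" and M: "0 < M" and C: "0 \<le> C" and p: "p < 1"
    and res: "\<And>z. z \<in> Omega \<phi> r \<Longrightarrow> z \<in> resolvent_set S"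
    and below: "\<And>z. z \<in> Omega \<phi> r \<Longrightarrow> bounded_below S z (M / cmod z)"
    and small: "\<And>z x. z \<in> Omega \<phi> r \<Longrightarrow> x \<in> op_dom S \<Longrightarrow>
      norm (op_app R x) \<le> C * cmod z powr (p - 1) * norm (op_app S x - z *\<^sub>C x)"
  obtains r' where "r \<le> r'"
    and "\<And>z. z \<in> Omega \<phi> r' \<Longrightarrow> z \<in> resolvent_set (op_plus S R)"
    and "\<And>z. z \<in> Omega \<phi> r' \<Longrightarrow> bounded_below (op_plus S R) z (2 * M / cmod z)"
proof -
  have "((\<lambda>x. C * x powr (p - 1)) \<longlongrightarrow> 0) at_top"
    using p by (intro tendsto_mult_right_zero tendsto_neg_powr filterlim_ident) auto
  then have "\<forall>\<^sub>F x in at_top. C * x powr (p - 1) < 1 / 2" by (rule order_tendstoD) simp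
  then obtain B where B: "\<And>x. B \<le> x \<Longrightarrow> C * x powr (p - 1) < 1 / 2"
    by (auto simp: eventually_at_top_linorder)
  let ?T = "op_plus S R"
  have *: "z \<in> resolvent_set ?T \<and> bounded_below ?T z (2 * M / cmod z)" if z: "z \<in> Omega \<phi> (max r B)" for z
  proof -
    have z': "z \<in> Omega \<phi> r" "B \<le> cmod z" "0 < cmod z" using z r by (auto simp: Omega_def)
    have sm: "norm ((op_app ?T x - z *\<^sub>C x) - (op_app S x - z *\<^sub>C x))
        \<le> 1 / 2 * norm (op_app S x - z *\<^sub>C x)" if x: "x \<in> op_dom S" for x
    proof -
      have "norm (op_app R x) \<le> C * cmod z powr (p - 1) * norm (op_app S x - z *\<^sub>C x)"
        by (rule small[OF z'(1) x])
      also have "\<dots> \<le> 1 / 2 * norm (op_app S x - z *\<^sub>C x)"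
        using B[OF z'(2)] by (intro mult_right_mono) auto
      finally show ?thesis by (simp add: op_plus_simps[OF dom])
    qed
    have m: "0 \<le> M / cmod z" using M by simp
    note perturb = resolvent_set_perturb[OF lin(1) linear_operator_op_plus[OF lin dom]
        op_plus_simps(1)[OF dom] res[OF z'(1)] below[OF z'(1)] sm _ _ m]
    have "bounded_below ?T z (M / cmod z / (1 - 1 / 2))" by (rule perturb) auto
    moreover have "z \<in> resolvent_set ?T" by (rule perturb) auto
    ultimately show ?thesis by (simp add: mult.commute)
  qed
  show thesis by (rule that[of "max r B"]) (use * in auto)
qed

lemma shift_along_axis:
  fixes x :: "'a::complex_normed_vector"
  shows "norm ((y - (\<i> * complex_of_real s) *\<^sub>C x) - (y - (\<i> * complex_of_real t) *\<^sub>C x)) = \<bar>s - t\<bar> * norm x"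
proof -
  have "(y - (\<i> * complex_of_real s) *\<^sub>C x) - (y - (\<i> * complex_of_real t) *\<^sub>C x)
      = (\<i> * complex_of_real (t - s)) *\<^sub>C x"
    by (simp add: scaleC.scale_left_diff_distrib right_diff_distrib)
  then show ?thesis by (simp add: norm_scaleC norm_mult abs_minus_commute del: of_real_diff)
qed

text \<open>A lower estimate persists nearby with half the constant, and a resolvent point with a lower
  estimate is the centre of a disc of resolvent points whose radius depends on that constant only.
  Hence, within distance \<open>c / 4\<close>, being a resolvent point passes from \<open>s\<close> to \<open>t\<close> and back.\<close>

lemma regular_point_neighbourhood:
  fixes T :: "'a::complex_banach operator"
  assumes lin: "linear_operator T" and reg: "\<i> * complex_of_real t \<in> regular_points T"
  obtains d m where "0 < d" "0 \<le> m"
    and "\<And>s. \<bar>s - t\<bar> \<le> d \<Longrightarrow> bounded_below T (\<i> * complex_of_real s) m"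
    and "\<And>s. \<bar>s - t\<bar> \<le> d \<Longrightarrow>
      \<i> * complex_of_real s \<in> resolvent_set T \<longleftrightarrow> \<i> * complex_of_real t \<in> resolvent_set T"
proof -
  obtain c where c: "0 < c" and cT: "\<And>x. x \<in> op_dom T \<Longrightarrow>
      c * norm x \<le> norm (op_app T x - (\<i> * complex_of_real t) *\<^sub>C x)"
    using reg by (auto simp: regular_points_def)
  have below: "bounded_below T (\<i> * complex_of_real s) (2 / c)" if s: "\<bar>s - t\<bar> \<le> c / 4" for s
    unfolding bounded_below_def
  proof
    fix x assume x: "x \<in> op_dom T"
    let ?u = "op_app T x - (\<i> * complex_of_real s) *\<^sub>C x"
    let ?v = "op_app T x - (\<i> * complex_of_real t) *\<^sub>C x"
    have "norm ?v \<le> norm ?u + norm (?u - ?v)"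
      by (metis add.commute norm_triangle_sub norm_minus_commute)
    also have "norm (?u - ?v) \<le> c / 4 * norm x"
      unfolding shift_along_axis using s by (intro mult_right_mono) auto
    finally have "c * norm x \<le> norm ?u + (c * norm x) / 4" using cT[OF x] by simp
    moreover have "0 \<le> c * norm x" using c by simp
    ultimately have "(c * norm x) / 2 \<le> norm ?u" by linarith
    then show "norm x \<le> 2 / c * norm ?u" using c by (simp add: field_simps)
  qed
  have step: "\<i> * complex_of_real s' \<in> resolvent_set T"
    if s: "\<bar>s - t\<bar> \<le> c / 4" and d: "\<bar>s' - s\<bar> \<le> c / 4"
      and res: "\<i> * complex_of_real s \<in> resolvent_set T" for s s'
  proof (rule resolvent_set_perturb(1)[OF lin lin refl res below[OF s]])
    fix x assume x: "x \<in> op_dom T"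
    let ?n = "norm (op_app T x - (\<i> * complex_of_real s) *\<^sub>C x)"
    have "\<bar>s' - s\<bar> * norm x \<le> c / 4 * (2 / c * ?n)"
      using d c below[OF s] x by (intro mult_mono) (auto simp: bounded_below_def)
    also have "\<dots> = 1 / 2 * ?n" using c by simp
    finally show "norm ((op_app T x - (\<i> * complex_of_real s') *\<^sub>C x) - (op_app T x - (\<i> * complex_of_real s) *\<^sub>C x))
        \<le> 1 / 2 * ?n"
      unfolding shift_along_axis .
  qed (use c in auto)
  show thesis
  proof (rule that[of "c / 4" "2 / c"])
    show "\<i> * complex_of_real s \<in> resolvent_set T \<longleftrightarrow> \<i> * complex_of_real t \<in> resolvent_set T"
      if "\<bar>s - t\<bar> \<le> c / 4" for s
      using step[of s t] step[of t s] that c by (auto simp: abs_minus_commute)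
  qed (use c below in auto)
qed

text \<open>The resolvent points form an open and closed subset of the axis.\<close>

lemma imaginary_axis_in_resolvent_set:
  fixes T :: "'a::complex_banach operator"
  assumes lin: "linear_operator T"
    and reg: "\<And>t. \<i> * complex_of_real t \<in> regular_points T"
    and one: "\<i> * complex_of_real t0 \<in> resolvent_set T"
  shows "\<i> * complex_of_real t \<in> resolvent_set T"
proof -
  define A where "A = {t. \<i> * complex_of_real t \<in> resolvent_set T}"
  have nbhd: "\<exists>d>0. \<forall>s. \<bar>s - t\<bar> \<le> d \<longrightarrow> (s \<in> A \<longleftrightarrow> t \<in> A)" for t
    using regular_point_neighbourhood[OF lin reg[of t]] unfolding A_def mem_Collect_eq by metis
  have "open A" "open (- A)"
    unfolding open_dist dist_real_def using nbhd by (metis less_imp_le, metis ComplI ComplD less_imp_le)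
  moreover have "t0 \<in> A" using one by (simp add: A_def)
  ultimately have "A = UNIV" by (metis clopen closed_def empty_iff)
  then show ?thesis by (auto simp: A_def)
qed

text \<open>The local constants around points of regular type are combined over a compact interval; outside of
  it the assumed decay takes over.\<close>

lemma uniform_resolvent_bound:
  fixes T :: "'a::complex_banach operator"
  assumes lin: "linear_operator T"
    and reg: "\<And>t. \<i> * complex_of_real t \<in> regular_points T"
    and far: "\<And>t. \<rho> < \<bar>t\<bar> \<Longrightarrow> bounded_below T (\<i> * complex_of_real t) (M / \<bar>t\<bar>)"
    and M: "0 \<le> M"
  obtains K where "0 \<le> K" "\<And>t. bounded_below T (\<i> * complex_of_real t) (K / (1 + \<bar>t\<bar>))"
proof -
  define b where "b = max \<rho> 1"
  have "\<exists>m. \<forall>s. - b \<le> s \<and> s \<le> b \<longrightarrow> bounded_below T (\<i> * complex_of_real s) m"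
  proof (rule Bolzano[where P = "\<lambda>a b. \<exists>m. \<forall>s. a \<le> s \<and> s \<le> b \<longrightarrow> bounded_below T (\<i> * complex_of_real s) m"])
    show "- b \<le> b" by (simp add: b_def)
  next
    fix a1 a2 a3 :: real
    assume "\<exists>m. \<forall>s. a1 \<le> s \<and> s \<le> a2 \<longrightarrow> bounded_below T (\<i> * complex_of_real s) m"
      and "\<exists>m. \<forall>s. a2 \<le> s \<and> s \<le> a3 \<longrightarrow> bounded_below T (\<i> * complex_of_real s) m"
    then obtain m1 m2
      where m: "\<And>s. a1 \<le> s \<Longrightarrow> s \<le> a2 \<Longrightarrow> bounded_below T (\<i> * complex_of_real s) m1"
        "\<And>s. a2 \<le> s \<Longrightarrow> s \<le> a3 \<Longrightarrow> bounded_below T (\<i> * complex_of_real s) m2"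
      by blast
    have "bounded_below T (\<i> * complex_of_real s) (max m1 m2)" if "a1 \<le> s" "s \<le> a3" for s
    proof (cases "s \<le> a2")
      case True
      from bounded_below_mono[OF m(1)[OF that(1) True]] show ?thesis by simp
    next
      case False
      then have "a2 \<le> s" by simp
      from bounded_below_mono[OF m(2)[OF this that(2)]] show ?thesis by simp
    qed
    then show "\<exists>m. \<forall>s. a1 \<le> s \<and> s \<le> a3 \<longrightarrow> bounded_below T (\<i> * complex_of_real s) m" by blast
  next
    fix t :: real
    obtain d m where "0 < d" "\<And>s. \<bar>s - t\<bar> \<le> d \<Longrightarrow> bounded_below T (\<i> * complex_of_real s) m"
      using regular_point_neighbourhood[OF lin reg[of t]] by metis
    then show "\<exists>d>0. \<forall>a b. a \<le> t \<and> t \<le> b \<and> b - a < d \<longrightarrow>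
        (\<exists>m. \<forall>s. a \<le> s \<and> s \<le> b \<longrightarrow> bounded_below T (\<i> * complex_of_real s) m)"
      by (intro exI[of _ d] conjI allI impI exI[of _ m]) auto
  qed
  then obtain m where m: "\<And>s. - b \<le> s \<Longrightarrow> s \<le> b \<Longrightarrow> bounded_below T (\<i> * complex_of_real s) m" by blast
  define K where "K = max (2 * M) (\<bar>m\<bar> * (1 + b))"
  show thesis
  proof (rule that)
    show "0 \<le> K" using M by (simp add: K_def)
    fix t :: real
    show "bounded_below T (\<i> * complex_of_real t) (K / (1 + \<bar>t\<bar>))"
    proof (cases "\<bar>t\<bar> \<le> b")
      case True
      have "m * (1 + \<bar>t\<bar>) \<le> \<bar>m\<bar> * (1 + b)" using True by (intro mult_mono) auto
      also have "\<dots> \<le> K" by (simp add: K_def)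
      finally have "m \<le> K / (1 + \<bar>t\<bar>)" by (simp add: pos_le_divide_eq add_pos_nonneg)
      moreover have "bounded_below T (\<i> * complex_of_real t) m" using m[of t] True by simp
      ultimately show ?thesis using bounded_below_mono by blast
    next
      case False
      then have t: "\<rho> < \<bar>t\<bar>" "1 < \<bar>t\<bar>" by (auto simp: b_def)
      have "M * (1 + \<bar>t\<bar>) \<le> M * (2 * \<bar>t\<bar>)" using M t by (intro mult_left_mono) auto
      also have "\<dots> = 2 * M * \<bar>t\<bar>" by simp
      also have "\<dots> \<le> K * \<bar>t\<bar>" by (intro mult_right_mono) (auto simp: K_def)
      finally have "M / \<bar>t\<bar> \<le> K / (1 + \<bar>t\<bar>)"
        using t by (simp add: frac_le_eq divide_le_eq add_pos_nonneg pos_le_divide_eq)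
      with far[OF t(1)] show ?thesis by (rule bounded_below_mono)
    qed
  qed
qed

section \<open>The perturbation theorem\<close>

lemma resolvent_op_plus_diff:
  assumes lin: "linear_operator (op_plus S R)" and dom: "op_dom S \<subseteq> op_dom R"
    and z: "z \<in> resolvent_set S" "z \<in> resolvent_set (op_plus S R)"
  shows "resolvent S z x - resolvent (op_plus S R) z x
    = resolvent (op_plus S R) z (op_app R (resolvent S z x))"
proof -
  let ?u = "resolvent S z x"
  have u: "?u \<in> op_dom S" using z(1) by (rule resolvent_in_dom)
  have "?u = resolvent (op_plus S R) z (op_app (op_plus S R) ?u - z *\<^sub>C ?u)"
    by (rule resolvent_left[symmetric]) (use z u in \<open>simp_all add: op_plus_simps[OF dom]\<close>)
  also have "op_app (op_plus S R) ?u - z *\<^sub>C ?u = x + op_app R ?u"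
    by (simp add: op_plus_simps[OF dom] op_app_resolvent z(1))
  also have "resolvent (op_plus S R) z \<dots>
      = resolvent (op_plus S R) z x + resolvent (op_plus S R) z (op_app R ?u)"
    by (rule linear_add[OF bounded_linear.linear[OF bounded_linear_resolvent[OF lin z(2)]]])
  finally have "?u = resolvent (op_plus S R) z x + resolvent (op_plus S R) z (op_app R ?u)" .
  from arg_cong[OF this, of "\<lambda>u. u - resolvent (op_plus S R) z x"] show ?thesis by simp
qed

text \<open>A difference that decays faster than \<open>1 / |t|\<close> has a convergent integral of its own.\<close>

lemma pv_integral_transfer:
  fixes f g :: "real \<Rightarrow> 'a::banach"
  assumes f: "\<And>N. 0 < N \<Longrightarrow> f integrable_on {-N..N}" and g: "\<And>N. g integrable_on {-N..N}"
    and lim: "((\<lambda>N. integral {-N..N} f) \<longlongrightarrow> L) at_top"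
    and close: "\<And>t. \<rho> < \<bar>t\<bar> \<Longrightarrow> norm (f t - g t) \<le> C * \<bar>t\<bar> powr (- q)" and q: "1 < q"
  shows "\<exists>L. ((\<lambda>N. integral {-N..N} g) \<longlongrightarrow> L) at_top"
proof -
  define d where "d t = f t - g t" for t
  have d: "d integrable_on {-N..N}" if "0 < N" for N
    unfolding d_def using f[OF that] g by (rule integrable_diff)
  define e where "e t = d t + d (- t)" for t
  have e: "e integrable_on {a..b}" if "0 \<le> a" for a b
  proof -
    have "d integrable_on {- (\<bar>b\<bar> + 1)..\<bar>b\<bar> + 1}" by (rule d) simp
    then have sub: "d integrable_on {a'..b'}" if "- (\<bar>b\<bar> + 1) \<le> a'" "b' \<le> \<bar>b\<bar> + 1" for a' b'
      by (rule integrable_on_subinterval) (use that in auto)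
    have "d integrable_on {-b..-a}" by (rule sub) (use \<open>0 \<le> a\<close> in auto)
    then have "(\<lambda>t. d (- t)) integrable_on {a..b}"
      using Henstock_Kurzweil_Integration.integrable_reflect_real[of "\<lambda>t. d (- t)" b a] by simp
    moreover have "d integrable_on {a..b}" by (rule sub) (use \<open>0 \<le> a\<close> in auto)
    ultimately show ?thesis unfolding e_def by (intro integrable_add)
  qed
  have "\<exists>L. ((\<lambda>N. integral {0..N} e) \<longlongrightarrow> L) at_top"
  proof (rule improper_integral_power_decay[of e "\<bar>\<rho>\<bar> + 1" "2 * C" q])
    fix t :: real assume t: "\<bar>\<rho>\<bar> + 1 \<le> t"
    have "norm (e t) \<le> C * \<bar>t\<bar> powr (- q) + C * \<bar>- t\<bar> powr (- q)"
      unfolding e_def d_def by (intro norm_triangle_le add_mono close) (use t in auto)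
    with t show "norm (e t) \<le> 2 * C * t powr (- q)" by simp
  qed (use e q in auto)
  then obtain L' where L': "((\<lambda>N. integral {0..N} e) \<longlongrightarrow> L') at_top" by blast
  have "integral {-N..N} f - integral {0..N} e = integral {-N..N} g" if "0 < N" for N
  proof -
    have "integral {0..N} e = integral {-N..N} d"
      using integral_symmetric_interval[OF d[OF that]] that by (simp add: e_def[abs_def])
    also have "\<dots> = integral {-N..N} f - integral {-N..N} g"
      unfolding d_def using f[OF that] g by (rule Henstock_Kurzweil_Integration.integral_diff)
    finally show ?thesis by simp
  qed
  then have "\<forall>\<^sub>F N in at_top. integral {-N..N} f - integral {0..N} e = integral {-N..N} g"
    by (rule eventually_mono[OF eventually_gt_at_top[of 0]])
  from Lim_transform_eventually[OF tendsto_diff[OF lim L'] this] show ?thesis by blast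
qed

theorem theorem3p9:
  fixes S R :: "'a::complex_banach operator" and \<theta> r p :: real
  assumes "linear_operator S" and "densely_defined S" and "closed_operator S"
    and "{z. Re z = 0} \<subseteq> resolvent_set S"
    and "bisectorial S \<theta> r"
    and "\<And>x. \<exists>I. has_pv_integral (\<lambda>z. resolvent S z x) I"
    and "linear_operator R" and "p_subordinate p R S" and "p < 1"
    and "{z. Re z = 0} \<subseteq> regular_points (op_plus S R)"
  shows "\<exists>Vp Vm.
      dichotomous_wrt (op_plus S R) Vp Vm \<and>
      dichotomy_gap (op_plus S R) > 0 \<and>
      (\<forall>x. \<exists>I. has_pv_integral (\<lambda>z. resolvent (op_plus S R) z x) I \<and>
           (1 / (complex_of_real pi * \<i>)) *\<^sub>C I = proj_along Vp Vm x - proj_along Vm Vp x) \<and>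
      (\<exists>\<theta>''. \<theta> < \<theta>'' \<and> \<theta>'' < pi / 2 \<and> bisectorial (op_plus S R) \<theta>'' 0 \<and>
        (\<forall>\<theta>'. \<theta> < \<theta>' \<and> \<theta>' < pi / 2 \<longrightarrow>
          (\<exists>r'\<ge>r. bisectorial (op_plus S R) \<theta>' r' \<and>
             {z. ereal \<bar>Re z\<bar> < dichotomy_gap (op_plus S R)} \<union> Omega \<theta>'' 0 \<union> Omega \<theta>' r'
               \<subseteq> resolvent_set (op_plus S R))))"
proof -
  define T where "T = op_plus S R"
  have dom: "op_dom S \<subseteq> op_dom R" using assms(8) by (simp add: p_subordinate_def)
  have linT: "linear_operator T"
    unfolding T_def by (rule linear_operator_op_plus[OF assms(1,7) dom])
  have denseT: "densely_defined T"
    using assms(2) by (simp add: T_def densely_defined_def op_plus_simps[OF dom])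
  have \<theta>: "0 \<le> \<theta>" "\<theta> < pi / 2" and r: "0 \<le> r" using assms(5) by (simp_all add: bisectorial_def)
  have resS: "\<i> * complex_of_real t \<in> resolvent_set S" for t using assms(4) by auto
  have regT: "\<i> * complex_of_real t \<in> regular_points T" for t using assms(10) by (auto simp: T_def)

  have sector: "\<exists>r'\<ge>r. \<exists>M>0. \<forall>z\<in>Omega \<phi> r'. z \<in> resolvent_set T \<and> bounded_below T z (M / cmod z)"
    if \<phi>: "\<theta> < \<phi>" "\<phi> < pi / 2" for \<phi>
  proof -
    obtain M C where MC: "0 < M" "0 \<le> C"
      "\<And>z. z \<in> Omega \<phi> r \<Longrightarrow> z \<in> resolvent_set S"
      "\<And>z. z \<in> Omega \<phi> r \<Longrightarrow> bounded_below S z (M / cmod z)"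
      "\<And>z x. z \<in> Omega \<phi> r \<Longrightarrow> x \<in> op_dom S \<Longrightarrow>
        norm (op_app R x) \<le> C * cmod z powr (p - 1) * norm (op_app S x - z *\<^sub>C x)"
      using subordinate_small_on_bisector[OF assms(5,8,9) \<phi>(1) less_imp_le[OF \<phi>(2)]] by blast
    obtain r' where "r \<le> r'" "\<And>z. z \<in> Omega \<phi> r' \<Longrightarrow> z \<in> resolvent_set T"
      "\<And>z. z \<in> Omega \<phi> r' \<Longrightarrow> bounded_below T z (2 * M / cmod z)"
      using perturbed_bisector[OF assms(1,7) dom r MC(1,2) assms(9) MC(3-5)] unfolding T_def by blast
    then show ?thesis using MC(1) by (intro exI[of _ r'] conjI exI[of _ "2 * M"]) auto
  qed

  \<comment> \<open>On the imaginary axis itself the constants of the perturbation argument are needed explicitly.\<close>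
  obtain M C where M: "0 < M" and C: "0 \<le> C"
    and axis: "\<And>z. z \<in> Omega (pi / 2) r \<Longrightarrow> z \<in> resolvent_set S"
      "\<And>z. z \<in> Omega (pi / 2) r \<Longrightarrow> bounded_below S z (M / cmod z)"
    and small: "\<And>z x. z \<in> Omega (pi / 2) r \<Longrightarrow> x \<in> op_dom S \<Longrightarrow>
      norm (op_app R x) \<le> C * cmod z powr (p - 1) * norm (op_app S x - z *\<^sub>C x)"
    using subordinate_small_on_bisector[OF assms(5,8,9) \<theta>(2) order_refl] by blast
  obtain \<rho> where \<rho>: "r \<le> \<rho>"
    and \<rho>res: "\<And>z. z \<in> Omega (pi / 2) \<rho> \<Longrightarrow> z \<in> resolvent_set T"
    and \<rho>below: "\<And>z. z \<in> Omega (pi / 2) \<rho> \<Longrightarrow> bounded_below T z (2 * M / cmod z)"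
    using perturbed_bisector[OF assms(1,7) dom r M C assms(9) axis small] unfolding T_def by blast
  have \<rho>0: "0 \<le> \<rho>" using r \<rho> by simp
  have far: "bounded_below T (\<i> * complex_of_real t) (2 * M / \<bar>t\<bar>)" if "\<rho> < \<bar>t\<bar>" for t
    using \<rho>below[OF imaginary_in_Omega[OF order_refl that \<rho>0]] by (simp add: norm_mult)
  have "\<i> * complex_of_real (\<rho> + 1) \<in> resolvent_set T"
    by (rule \<rho>res, rule imaginary_in_Omega) (use \<rho>0 in auto)
  note resT = imaginary_axis_in_resolvent_set[OF linT regT this]
  obtain K where K: "0 \<le> K" "\<And>t. bounded_below T (\<i> * complex_of_real t) (K / (1 + \<bar>t\<bar>))"
    using uniform_resolvent_bound[OF linT regT far] M by (metis less_imp_le mult_pos_pos zero_less_numeral)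
  interpret imaginary_axis_resolvent T K
    by standard (use linT denseT resT K in auto)

  have pvT: "\<exists>L. ((\<lambda>N. integral {-N..N} (\<lambda>t. RB t x)) \<longlongrightarrow> L) at_top" for x
  proof -
    obtain I where I: "\<And>N. 0 < N \<Longrightarrow> (\<lambda>t. resolvent S (\<i> * complex_of_real t) x) integrable_on {-N..N}"
      "((\<lambda>N. \<i> *\<^sub>C integral {-N..N} (\<lambda>t. resolvent S (\<i> * complex_of_real t) x)) \<longlongrightarrow> I) at_top"
      using assms(6)[of x] by (auto simp: has_pv_integral_def)
    from bounded_linear.tendsto[OF bounded_linear_scaleC[of "- \<i>"] I(2)]
    have lim: "((\<lambda>N. integral {-N..N} (\<lambda>t. resolvent S (\<i> * complex_of_real t) x)) \<longlongrightarrow> - \<i> *\<^sub>C I) at_top"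
      by simp
    show ?thesis
    proof (rule pv_integral_transfer[OF I(1) integrable_RB(2) lim])
      fix t :: real assume t: "\<rho> < \<bar>t\<bar>"
      let ?z = "\<i> * complex_of_real t"
      have z: "?z \<in> Omega (pi / 2) r" by (rule imaginary_in_Omega) (use t \<rho> r in auto)
      have tz: "cmod ?z = \<bar>t\<bar>" "0 < \<bar>t\<bar>" using t \<rho>0 by (simp_all add: norm_mult)
      have "norm (resolvent S ?z x - RB t x) = norm (resolvent T ?z (op_app R (resolvent S ?z x)))"
        using resolvent_op_plus_diff[OF linT[unfolded T_def] dom resS resT[unfolded T_def],
            folded T_def, of t x]
        by (simp only: RB_apply)
      also have "\<dots> \<le> 2 * M / \<bar>t\<bar> * norm (op_app R (resolvent S ?z x))"
        by (rule norm_resolvent_le[OF resT far[OF t]])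
      also have "\<dots> \<le> 2 * M / \<bar>t\<bar> * (C * \<bar>t\<bar> powr (p - 1) * norm x)"
      proof (rule mult_left_mono)
        show "norm (op_app R (resolvent S ?z x)) \<le> C * \<bar>t\<bar> powr (p - 1) * norm x"
          using small[OF z resolvent_in_dom[OF resS[of t], of x]]
          by (simp add: resolvent_right resS tz)
      qed (use M in simp)
      also have "2 * M / \<bar>t\<bar> * (C * \<bar>t\<bar> powr (p - 1) * norm x)
          = (2 * M * C * norm x) * (\<bar>t\<bar> powr - 1 * \<bar>t\<bar> powr (p - 1))"
        using tz(2) by (simp add: powr_minus divide_inverse)
      also have "\<bar>t\<bar> powr - 1 * \<bar>t\<bar> powr (p - 1) = \<bar>t\<bar> powr - (2 - p)"
        unfolding powr_add[symmetric] by (rule arg_cong[where f = "(powr) \<bar>t\<bar>"]) simp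
      finally show "norm (resolvent S ?z x - RB t x) \<le> (2 * M * C * norm x) * \<bar>t\<bar> powr - (2 - p)" .
    qed (use assms(9) in auto)
  qed
  interpret pv_resolvent T K by standard (rule pvT)

  have pvI: "\<exists>I. has_pv_integral (\<lambda>z. resolvent T z x) I \<and>
      (1 / (complex_of_real pi * \<i>)) *\<^sub>C I
        = proj_along (eigenspace 1) (eigenspace (- 1)) x - proj_along (eigenspace (- 1)) (eigenspace 1) x" for x
  proof (intro exI conjI)
    show "has_pv_integral (\<lambda>z. resolvent T z x) (\<i> *\<^sub>C pi *\<^sub>R sign_op x)"
      unfolding has_pv_integral_def RB_apply[symmetric]
      using integrable_RB(2) bounded_linear.tendsto[OF bounded_linear_scaleC tendsto_sign_op] by blast
    show "(1 / (complex_of_real pi * \<i>)) *\<^sub>C (\<i> *\<^sub>C pi *\<^sub>R sign_op x)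
        = proj_along (eigenspace 1) (eigenspace (- 1)) x - proj_along (eigenspace (- 1)) (eigenspace 1) x"
      unfolding sign_op_eq_projections[symmetric] scaleR_scaleC scaleC_scaleC by simp
  qed

  obtain h where h: "0 < h" "{z. \<bar>Re z\<bar> < h} \<subseteq> resolvent_set T" using strip_in_resolvent_set by blast
  have "ereal h \<le> dichotomy_gap T"
    unfolding dichotomy_gap_def by (rule Sup_upper) (use h in auto)
  with h(1) have gap: "0 < dichotomy_gap T"
    using ereal_less(2) order_less_le_trans by blast
  have strip: "{z. ereal \<bar>Re z\<bar> < dichotomy_gap T} \<subseteq> resolvent_set T"
  proof
    fix z assume "z \<in> {z. ereal \<bar>Re z\<bar> < dichotomy_gap T}"
    then obtain h' where "ereal \<bar>Re z\<bar> < ereal h'" "{z. \<bar>Re z\<bar> < h'} \<subseteq> resolvent_set T"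
      unfolding dichotomy_gap_def less_Sup_iff mem_Collect_eq by blast
    then show "z \<in> resolvent_set T" by auto
  qed

  obtain \<phi> where \<phi>: "\<theta> < \<phi>" "\<phi> < pi / 2" "bisectorial T \<phi> 0" "Omega \<phi> 0 \<subseteq> resolvent_set T"
    using bisectorial_near_axis[OF \<theta>] by blast
  have outer: "\<exists>r'\<ge>r. bisectorial T \<theta>' r' \<and>
      {z. ereal \<bar>Re z\<bar> < dichotomy_gap T} \<union> Omega \<phi> 0 \<union> Omega \<theta>' r' \<subseteq> resolvent_set T"
    if \<theta>': "\<theta> < \<theta>' \<and> \<theta>' < pi / 2" for \<theta>'
  proof -
    obtain r' M' where r': "r \<le> r'" and M': "0 < M'"
      and O: "\<And>z. z \<in> Omega \<theta>' r' \<Longrightarrow> z \<in> resolvent_set T"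
        "\<And>z. z \<in> Omega \<theta>' r' \<Longrightarrow> bounded_below T z (M' / cmod z)"
      using sector[of \<theta>'] \<theta>' by blast
    have "bisectorial T \<theta>' r'"
      by (rule bisectorialI[OF linT denseT _ _ _ M' O]) (use \<theta> \<theta>' r r' in auto)
    then show ?thesis using r' O(1) strip \<phi>(4) by blast
  qed
  show ?thesis
    unfolding T_def[symmetric]
    using dichotomous_wrt_eigenspaces gap pvI \<phi>(1-3) outer by blast
qed

end
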